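(* Let $f_1,\dots,f_m:\mathbb{R}^d\to\mathbb{R}$ be convex and $L$-smooth ($L>0$), i.e. for all $x,y\in\mathbb{R}^d$ and $j\in[m]$, $f_j(y)\ge f_j(x)+\langle\nabla f_j(x),y-x\rangle$ and $\|\nabla f_j(x)-\nabla f_j(y)\|\le L\|x-y\|$. Let $f=\frac1m\sum_{j=1}^m f_j$ be $\mu$-strongly convex ($\mu>0$), i.e. $f(y)\ge f(x)+\langle\nabla f(x),y-x\rangle+\frac{\mu}{2}\|y-x\|^2$ for all $x,y\in\mathbb{R}^d$, and let $x^*$ be the minimizer of $f$. Assume in addition that there exists $\sigma\ge 0$ such that for every $x\in\mathbb{R}^d$ and $j$ sampled uniformly at random from $[m]$, $\mathbb{E}\|\nabla f_j(x)-\nabla f(x)\|^2\le\sigma^2$. Let the batchsize be $b\ge 1$ and let the stepsize satisfy $0<\gamma\le\min\left\{\frac{1}{12L},\frac{p}{\mu}\right\}$. Then the iterates produced by BR-LSVRG (defined in the context, with parameters $\gamma$, $b$, $p\in(0,1]$, starting point $x^0$, and a $(\delta,c)$-agnostic robust aggregator) after $K$ iterations satisfy $$\mathbb{E}\Psi_K\le\left(1-\frac{\gamma\mu}{2}\right)^K\Psi_0+\gamma\,\frac{32c\delta\sigma^2}{b\mu}+\frac{32c\delta\sigma^2}{b\mu^2},$$ where $\Psi_k=\|x^k-x^*\|^2+\frac{8\gamma^2}{p}\sigma_k^2$ and $\sigma_k^2=\frac{1}{Gm}\sum_{i\in\mathcal{G}}\sum_{j=1}^m\|\nabla f_j(w_i^k)-\nabla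 f_j(x^* )\|^2$.
   Context: Notation: $[t]=\{1,\dots,t\}$; $\langle\cdot,\cdot\rangle$ and $\|\cdot\|$ are the Euclidean inner product and norm on $\mathbb{R}^d$; $\mathbb{E}$ is the full expectation. Workers: there are $n$ workers, $[n]=\mathcal{G}\cup\mathcal{B}$ with $\mathcal{G}\cap\mathcal{B}=\varnothing$. Here $\mathcal{G}$ is the set of regular workers and $\mathcal{B}$ the set of Byzantine workers, with $|\mathcal{G}|=G\ge(1-\delta)n$ (equivalently $|\mathcal{B}|\le\delta n$) for some $0\le\delta<1/2$. Byzantine workers are omniscient and may send arbitrary vectors (which may depend on everything sent by other workers and on the aggregation rule). Robust aggregator: let $c>0$. A (possibly randomized) aggregation rule $\mathtt{ARAgg}(x_1,\dots,x_n)\in\mathbb{R}^d$ is a $(\delta,c)$-agnostic robust aggregator if it is computed without knowledge of the variance bound $\rho^2$ below and the following holds. Whenever $x_1,\dots,x_n$ are random vectors in $\mathbb{R}^d$ such that for some subset $\mathcal{G}\subseteq[n]$ with $|\mathcal{G}|=G\ge(1-\delta)n$ (not known to the rule) there is $\rho\ge0$ with $\frac{1}{G(G-1)}\sum_{i,l\in\mathcal{G}}\mathbb{E}\|x_i-x_l\|^2\le\rho^2$, the output $\widehat x=\mathtt{ARAgg}(x_1,\dots,x_n)$ satisfies $\mathbb{E}\|\widehat x-\overline x\|^2\le c\delta\rho^2$, where $\overline x=\frac1G\sum_{i\in\mathcal{G}}x_i$. (The normalization presupposes $G\ge2$.) In the algorithm, this property is used at each iteration conditionally on the past iterations. Algorithm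 BR-LSVRG: inputs are stepsize $\gamma>0$, integer batchsize $b\ge1$, starting point $x^0\in\mathbb{R}^d$, probability $p\in(0,1]$, a $(\delta,c)$-agnostic robust aggregator $\mathtt{ARAgg}$, and number of iterations $K$. Set $w_i^0=x^0$ for all $i\in\mathcal{G}$. For $k=0,1,\dots,K-1$: (1) the server sends $x^k$ to all workers; (2) each $i\in\mathcal{G}$ samples $j_{i,k}^1,\dots,j_{i,k}^b$ from $[m]$ uniformly at random, independently from each other and from other workers (and from the past), and sends to the server $$g_i^k=\frac1b\sum_{t=1}^b\left(\nabla f_{j_{i,k}^t}(x^k)-\nabla f_{j_{i,k}^t}(w_i^k)\right)+\nabla f(w_i^k);$$ (3) each $i\in\mathcal{G}$ sets $w_i^{k+1}=x^k$ with probability $p$ and $w_i^{k+1}=w_i^k$ with probability $1-p$ (probabilities conditional on the past iterations); (4) each $i\in\mathcal{B}$ sends an arbitrary vector $g_i^k$; (5) the server sets $x^{k+1}=x^k-\gamma\,\mathtt{ARAgg}(g_1^k,\dots,g_n^k)$. *)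

theory Defs
  imports "HOL-Probability.Probability"
begin

definition gradient :: "('v::euclidean_space \<Rightarrow> real) \<Rightarrow> 'v \<Rightarrow> 'v" where
  "gradient f x = (THE D. GDERIV f x :> D)"

lemma gradient_eqI:
  assumes "GDERIV f x :> D"
  shows "gradient f x = D"
  unfolding gradient_def
proof (rule the_equality)
  fix D' assume "GDERIV f x :> D'"
  with assms have "(\<lambda>h. h \<bullet> D') = (\<lambda>h. h \<bullet> D)"
    unfolding gderiv_def by (rule has_derivative_unique[rotated])
  then have "\<forall>h. h \<bullet> D' = h \<bullet> D" by meson
  then show "D' = D" by (simp add: vector_eq_ldot)
qed (rule assms)

lemma GDERIV_gradient:
  fixes f :: "'v::euclidean_space \<Rightarrow> real"
  assumes "f differentiable (at x)"
  shows "GDERIV f x :> gradient f x"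
proof -
  obtain f' where f': "(f has_derivative f') (at x)"
    using assms by (auto simp: differentiable_def)
  have "f' h = h \<bullet> (\<Sum>b\<in>Basis. f' b *\<^sub>R b)" for h
    using Linear_Algebra.linear_componentwise[OF has_derivative_linear[OF f'], of h 1]
    by (simp add: inner_sum_right mult.commute)
  then have "f' = (\<lambda>h. h \<bullet> (\<Sum>b\<in>Basis. f' b *\<^sub>R b))" by blast
  with f' have "GDERIV f x :> (\<Sum>b\<in>Basis. f' b *\<^sub>R b)"
    by (simp add: gderiv_def)
  with gradient_eqI show ?thesis by metis
qed

definition smooth :: "real \<Rightarrow> ('v::euclidean_space \<Rightarrow> real) \<Rightarrow> bool" where
  "smooth L f \<longleftrightarrow> (\<forall>x. f differentiable (at x)) \<and>
     (\<forall>x y. norm (gradient f x - gradient f y) \<le> L * norm (x - y))"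

definition average :: "nat set \<Rightarrow> (nat \<Rightarrow> 'v::real_vector) \<Rightarrow> 'v" where
  "average I v = (1 / real (card I)) *\<^sub>R (\<Sum>i\<in>I. v i)"

definition objective :: "nat \<Rightarrow> (nat \<Rightarrow> 'v::euclidean_space \<Rightarrow> real) \<Rightarrow> 'v \<Rightarrow> real" where
  "objective m f x = (1 / real m) * (\<Sum>j=1..m. f j x)"

text \<open>A possibly randomized aggregation rule for \<open>n\<close> vectors is a Markov kernel: \<open>A v\<close> is the
  distribution of the output on the input tuple \<open>v\<close>, which is indexed by \<open>{1..n}\<close>.\<close>

definition aggregation_rule ::
    "nat \<Rightarrow> ((nat \<Rightarrow> 'v::euclidean_space) \<Rightarrow> 'v measure) \<Rightarrow> bool" where
  "aggregation_rule n A \<longleftrightarrow> A \<in> (\<Pi>\<^sub>M i\<in>{1..n}. borel) \<rightarrow>\<^sub>M prob_algebra borel"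

text \<open>The random vectors \<open>x\<^sub>1, \<dots>, x\<^sub>n\<close> enter only through their joint distribution \<open>P\<close>, because a
  definition cannot quantify over sample spaces of every type; the lemma below recovers arbitrary
  sample spaces. The rule \<open>A\<close> is chosen before the set \<open>\<G>\<close> and the bound \<open>\<rho>\<close>.
  Expectations of squared norms are \<open>ennreal\<close>-valued, so a non-integrable one is infinite.\<close>

definition agnostic_robust_aggregator ::
    "nat \<Rightarrow> real \<Rightarrow> real \<Rightarrow> ((nat \<Rightarrow> 'v::euclidean_space) \<Rightarrow> 'v measure) \<Rightarrow> bool" where
  "agnostic_robust_aggregator n \<delta> c A \<longleftrightarrow> aggregation_rule n A \<and>
     (\<forall>P \<G> \<rho>. prob_space P \<and> sets P = sets (\<Pi>\<^sub>M i\<in>{1..n}. borel) \<and>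
        \<G> \<subseteq> {1..n} \<and> (1 - \<delta>) * real n \<le> real (card \<G>) \<and> 2 \<le> card \<G> \<and> 0 \<le> \<rho> \<and>
        ennreal (1 / (real (card \<G>) * (real (card \<G>) - 1))) *
          (\<Sum>i\<in>\<G>. \<Sum>l\<in>\<G>. \<integral>\<^sup>+v. ennreal ((norm (v i - v l))\<^sup>2) \<partial>P) \<le> ennreal (\<rho>\<^sup>2)
        \<longrightarrow> (\<integral>\<^sup>+v. (\<integral>\<^sup>+y. ennreal ((norm (y - average \<G> v))\<^sup>2) \<partial>A v) \<partial>P)
              \<le> ennreal (c * \<delta> * \<rho>\<^sup>2))"

lemma agnostic_robust_aggregator_random_vectors:
  fixes X :: "nat \<Rightarrow> '\<omega> \<Rightarrow> 'v::euclidean_space"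
  assumes A: "agnostic_robust_aggregator n \<delta> c A" and M: "prob_space M"
    and X: "\<And>i. i \<in> {1..n} \<Longrightarrow> X i \<in> borel_measurable M"
    and \<G>: "\<G> \<subseteq> {1..n}" "(1 - \<delta>) * real n \<le> real (card \<G>)" "2 \<le> card \<G>" and \<rho>: "0 \<le> \<rho>"
    and bound: "ennreal (1 / (real (card \<G>) * (real (card \<G>) - 1))) *
      (\<Sum>i\<in>\<G>. \<Sum>l\<in>\<G>. \<integral>\<^sup>+\<omega>. ennreal ((norm (X i \<omega> - X l \<omega>))\<^sup>2) \<partial>M) \<le> ennreal (\<rho>\<^sup>2)"
  shows "(\<integral>\<^sup>+\<omega>. (\<integral>\<^sup>+y. ennreal ((norm (y - average \<G> (\<lambda>i. X i \<omega>)))\<^sup>2)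
            \<partial>A (\<lambda>i\<in>{1..n}. X i \<omega>)) \<partial>M) \<le> ennreal (c * \<delta> * \<rho>\<^sup>2)"
proof -
  let ?N = "\<Pi>\<^sub>M i\<in>{1..n}. (borel :: 'v measure)"
  let ?X = "\<lambda>\<omega>. \<lambda>i\<in>{1..n}. X i \<omega>"
  have X_meas: "?X \<in> M \<rightarrow>\<^sub>M ?N"
    using X by (intro measurable_restrict) auto
  have A_meas: "A \<in> ?N \<rightarrow>\<^sub>M subprob_algebra borel"
    using A by (auto simp: agnostic_robust_aggregator_def aggregation_rule_def
        intro: measurable_prob_algebraD)
  have comp: "(\<lambda>v. v i) \<in> borel_measurable ?N" if "i \<in> \<G>" for i
    using that \<G>(1) by (intro measurable_component_singleton) auto
  have avg: "average \<G> \<in> borel_measurable ?N"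
    unfolding average_def using comp
    by (intro borel_measurable_scaleR borel_measurable_sum) auto
  have inner_meas: "(\<lambda>v. \<integral>\<^sup>+y. ennreal ((norm (y - average \<G> v))\<^sup>2) \<partial>A v) \<in> borel_measurable ?N"
  proof (rule nn_integral_measurable_subprob_algebra2[OF _ A_meas])
    note [measurable] = measurable_compose[OF measurable_fst avg]
    show "(\<lambda>(v, y). ennreal ((norm (y - average \<G> v))\<^sup>2))
        \<in> borel_measurable (?N \<Otimes>\<^sub>M borel)"
      by measurable
  qed
  have P: "prob_space (distr M ?N ?X)"
    using M X_meas by (rule prob_space.prob_space_distr)
  have pair: "(\<integral>\<^sup>+v. ennreal ((norm (v i - v l))\<^sup>2) \<partial>distr M ?N ?X)
      = (\<integral>\<^sup>+\<omega>. ennreal ((norm (X i \<omega> - X l \<omega>))\<^sup>2) \<partial>M)" if "i \<in> \<G>" "l \<in> \<G>" for i l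
  proof -
    have "(\<lambda>v. ennreal ((norm (v i - v l))\<^sup>2)) \<in> borel_measurable ?N"
      using comp[OF that(1)] comp[OF that(2)] by measurable
    moreover have "i \<in> {1..n}" "l \<in> {1..n}" using that \<G>(1) by auto
    ultimately show ?thesis
      using X_meas by (subst nn_integral_distr) auto
  qed
  have "(\<integral>\<^sup>+v. (\<integral>\<^sup>+y. ennreal ((norm (y - average \<G> v))\<^sup>2) \<partial>A v) \<partial>distr M ?N ?X)
      \<le> ennreal (c * \<delta> * \<rho>\<^sup>2)"
    using A P \<G> \<rho> bound pair
    unfolding agnostic_robust_aggregator_def by (auto simp: sets_distr)
  also have "(\<integral>\<^sup>+v. (\<integral>\<^sup>+y. ennreal ((norm (y - average \<G> v))\<^sup>2) \<partial>A v) \<partial>distr M ?N ?X)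
      = (\<integral>\<^sup>+\<omega>. (\<integral>\<^sup>+y. ennreal ((norm (y - average \<G> (?X \<omega>)))\<^sup>2) \<partial>A (?X \<omega>)) \<partial>M)"
    using X_meas inner_meas by (simp add: nn_integral_distr)
  also have "(\<lambda>\<omega>. average \<G> (?X \<omega>)) = (\<lambda>\<omega>. average \<G> (\<lambda>i. X i \<omega>))"
    unfolding average_def using \<G>(1)
    by (intro ext arg_cong2[where f = scaleR] sum.cong) auto
  finally show ?thesis .
qed

text \<open>Indices: \<open>k\<close> is the iteration, \<open>i\<close> the worker, \<open>t\<close> the position in the minibatch.
  \<open>smp k i t\<close> is the sampled component, \<open>coin k i\<close> says whether worker \<open>i\<close> refreshes its reference
  point \<open>w\<close>, \<open>g k i\<close> is the message of worker \<open>i\<close>, and \<open>agg k\<close> is the output of the aggregation rule.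
  \<open>past k\<close> is generated by everything that happened in the iterations before \<open>k\<close>.\<close>

definition generated :: "'\<omega> measure \<Rightarrow> 'c measure \<Rightarrow> ('\<omega> \<Rightarrow> 'c) \<Rightarrow> '\<omega> set set" where
  "generated M N X = sets (vimage_algebra (space M) X N)"

definition past ::
    "'\<omega> measure \<Rightarrow> nat \<Rightarrow> nat set \<Rightarrow> nat \<Rightarrow> (nat \<Rightarrow> nat \<Rightarrow> nat \<Rightarrow> '\<omega> \<Rightarrow> nat) \<Rightarrow>
     (nat \<Rightarrow> nat \<Rightarrow> '\<omega> \<Rightarrow> bool) \<Rightarrow> (nat \<Rightarrow> nat \<Rightarrow> '\<omega> \<Rightarrow> 'v::euclidean_space) \<Rightarrow>
     (nat \<Rightarrow> '\<omega> \<Rightarrow> 'v) \<Rightarrow> nat \<Rightarrow> '\<omega> measure" where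
  "past M n \<G> b smp coin g agg k = sigma (space M) (\<Union>l<k.
     (\<Union>i\<in>\<G>. \<Union>t\<in>{1..b}. generated M (count_space UNIV) (smp l i t)) \<union>
     (\<Union>i\<in>\<G>. generated M (count_space UNIV) (coin l i)) \<union>
     (\<Union>i\<in>{1..n}. generated M borel (g l i)) \<union>
     generated M borel (agg l))"

definition past_and_messages ::
    "'\<omega> measure \<Rightarrow> nat \<Rightarrow> nat set \<Rightarrow> nat \<Rightarrow> (nat \<Rightarrow> nat \<Rightarrow> nat \<Rightarrow> '\<omega> \<Rightarrow> nat) \<Rightarrow>
     (nat \<Rightarrow> nat \<Rightarrow> '\<omega> \<Rightarrow> bool) \<Rightarrow> (nat \<Rightarrow> nat \<Rightarrow> '\<omega> \<Rightarrow> 'v::euclidean_space) \<Rightarrow>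
     (nat \<Rightarrow> '\<omega> \<Rightarrow> 'v) \<Rightarrow> nat \<Rightarrow> '\<omega> measure" where
  "past_and_messages M n \<G> b smp coin g agg k = sigma (space M)
     (sets (past M n \<G> b smp coin g agg k) \<union> (\<Union>i\<in>{1..n}. generated M borel (g k i)))"

text \<open>The messages of workers outside \<open>\<G>\<close> are only required to be random vectors: they may depend on
  the past, on the samples, coins and messages of the current iteration, and on \<open>A\<close>.
  In \<open>smp_indep\<close>, \<open>None\<close> stands for the past and \<open>Some (i, t)\<close> for a sample.\<close>

locale br_lsvrg = prob_space M
  for M :: "'\<omega> measure" +
  fixes n :: nat and \<G> :: "nat set" and m :: nat
    and f :: "nat \<Rightarrow> 'v::euclidean_space \<Rightarrow> real"
    and A :: "(nat \<Rightarrow> 'v) \<Rightarrow> 'v measure"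
    and \<gamma> :: real and b :: nat and p :: real and x0 :: 'v and K :: nat
    and x :: "nat \<Rightarrow> '\<omega> \<Rightarrow> 'v"
    and w :: "nat \<Rightarrow> nat \<Rightarrow> '\<omega> \<Rightarrow> 'v"
    and g :: "nat \<Rightarrow> nat \<Rightarrow> '\<omega> \<Rightarrow> 'v"
    and smp :: "nat \<Rightarrow> nat \<Rightarrow> nat \<Rightarrow> '\<omega> \<Rightarrow> nat"
    and coin :: "nat \<Rightarrow> nat \<Rightarrow> '\<omega> \<Rightarrow> bool"
    and agg :: "nat \<Rightarrow> '\<omega> \<Rightarrow> 'v"
  assumes x_init: "\<And>\<omega>. \<omega> \<in> space M \<Longrightarrow> x 0 \<omega> = x0"
    and w_init: "\<And>i \<omega>. i \<in> \<G> \<Longrightarrow> \<omega> \<in> space M \<Longrightarrow> w 0 i \<omega> = x0"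
    and smp_uniform: "\<And>k i t. k < K \<Longrightarrow> i \<in> \<G> \<Longrightarrow> t \<in> {1..b} \<Longrightarrow>
      random_variable (count_space UNIV) (smp k i t) \<and>
      distr M (count_space UNIV) (smp k i t) = measure_pmf (pmf_of_set {1..m})"
    and smp_indep: "\<And>k. k < K \<Longrightarrow> indep_sets
      (\<lambda>s. case s of None \<Rightarrow> sets (past M n \<G> b smp coin g agg k)
                   | Some (i, t) \<Rightarrow> generated M (count_space UNIV) (smp k i t))
      (insert None (Some ` (\<G> \<times> {1..b})))"
    and g_random: "\<And>k i. k < K \<Longrightarrow> i \<in> {1..n} \<Longrightarrow> random_variable borel (g k i)"
    and g_regular: "\<And>k i \<omega>. k < K \<Longrightarrow> i \<in> \<G> \<Longrightarrow> \<omega> \<in> space M \<Longrightarrow>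
      g k i \<omega> = (1 / real b) *\<^sub>R (\<Sum>t=1..b. gradient (f (smp k i t \<omega>)) (x k \<omega>)
                                        - gradient (f (smp k i t \<omega>)) (w k i \<omega>))
                + gradient (objective m f) (w k i \<omega>)"
    and coin_random: "\<And>k i. k < K \<Longrightarrow> i \<in> \<G> \<Longrightarrow> random_variable (count_space UNIV) (coin k i)"
    and coin_prob: "\<And>k i. k < K \<Longrightarrow> i \<in> \<G> \<Longrightarrow> AE \<omega> in M.
      real_cond_exp M (past M n \<G> b smp coin g agg k)
        (indicator {\<omega> \<in> space M. coin k i \<omega>}) \<omega> = p"
    and w_step: "\<And>k i \<omega>. k < K \<Longrightarrow> i \<in> \<G> \<Longrightarrow> \<omega> \<in> space M \<Longrightarrow>
      w (Suc k) i \<omega> = (if coin k i \<omega> then x k \<omega> else w k i \<omega>)"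
    and agg_random: "\<And>k. k < K \<Longrightarrow> random_variable borel (agg k)"
    and agg_law: "\<And>k S. k < K \<Longrightarrow> S \<in> sets borel \<Longrightarrow> AE \<omega> in M.
      real_cond_exp M (past_and_messages M n \<G> b smp coin g agg k)
        (indicator {\<omega> \<in> space M. agg k \<omega> \<in> S}) \<omega> = measure (A (\<lambda>i\<in>{1..n}. g k i \<omega>)) S"
    and x_step: "\<And>k \<omega>. k < K \<Longrightarrow> \<omega> \<in> space M \<Longrightarrow> x (Suc k) \<omega> = x k \<omega> - \<gamma> *\<^sub>R agg k \<omega>"

definition reference_error ::
    "nat set \<Rightarrow> nat \<Rightarrow> (nat \<Rightarrow> 'v::euclidean_space \<Rightarrow> real) \<Rightarrow> 'v \<Rightarrow> (nat \<Rightarrow> 'v) \<Rightarrow> real" where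
  "reference_error \<G> m f xs w = (1 / (real (card \<G>) * real m)) *
     (\<Sum>i\<in>\<G>. \<Sum>j=1..m. (norm (gradient (f j) (w i) - gradient (f j) xs))\<^sup>2)"

definition lyapunov ::
    "nat set \<Rightarrow> nat \<Rightarrow> (nat \<Rightarrow> 'v::euclidean_space \<Rightarrow> real) \<Rightarrow> real \<Rightarrow> real \<Rightarrow> 'v \<Rightarrow> 'v \<Rightarrow>
     (nat \<Rightarrow> 'v) \<Rightarrow> real" where
  "lyapunov \<G> m f \<gamma> p xs x w = (norm (x - xs))\<^sup>2 + (8 * \<gamma>\<^sup>2 / p) * reference_error \<G> m f xs w"

end

theory Submission
  imports Defs
begin

text \<open>The bound follows from a linear recursion for the expected Lyapunov function,

  \<open>E \<Psi>\<^sub>k\<^sub>+\<^sub>1 \<le> (1 - \<gamma> \<mu> / 2) E \<Psi>\<^sub>k + (2 \<gamma> / \<mu> + 2 \<gamma>\<^sup>2) (c \<delta> 8 \<sigma>\<^sup>2 / b)\<close>,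

  whose noise terms add up to at most the last one divided by \<open>\<gamma> \<mu> / 2\<close>. Three facts carry it.

  Few Byzantine workers do little harm. Given the past, the messages of the regular workers are
  independent and all have mean \<open>\<nabla>f(x\<^sup>k)\<close>. A message averages \<open>b\<close> independent estimates; the
  deviation of each from \<open>\<nabla>f(x\<^sup>k)\<close> is a difference of two centred component gradients, at \<open>x\<^sup>k\<close> and
  at the reference point, so its second moment is at most \<open>4 \<sigma>\<^sup>2\<close>. By orthogonality two messages are
  at mean square distance at most \<open>8 \<sigma>\<^sup>2 / b\<close>, however far the iterates are from the minimizer
  (\<open>integral_norm_message_diff_sq_le\<close>). The aggregator therefore misses the mean \<open>g\<close> of the regular
  messages by at most \<open>c \<delta> 8 \<sigma>\<^sup>2 / b\<close> in mean square (\<open>integral_aggregation_error_le\<close>). The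
  recursion concerns full expectations, and the error \<open>e\<close> of the aggregator enters it only through
  its second moment, so the aggregator property is applied to the joint law of the messages,
  without conditioning on the past.

  The exact step contracts. Let \<open>Q\<close> be the gradient gap at \<open>x\<^sup>k\<close>, the average over \<open>j\<close> of
  \<open>\<parallel>\<nabla>f\<^sub>j(x\<^sup>k) - \<nabla>f\<^sub>j(x\<^sup>*)\<parallel>\<^sup>2\<close>. Smoothness, convexity and strong convexity together give
  \<open>\<langle>\<nabla>f(x\<^sup>k), x\<^sup>k - x\<^sup>*\<rangle> \<ge> Q / (2 L) + (\<mu> / 2) \<parallel>x\<^sup>k - x\<^sup>*\<parallel>\<^sup>2\<close> (\<open>full_gradient_inner_ge\<close>). Half of the
  contraction \<open>1 - \<gamma> \<mu>\<close> pays for the inner product of \<open>e\<close> with \<open>x\<^sup>k - x\<^sup>*\<close>.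

  The variance is paid for by the reference points. The second moment of \<open>g\<close> is at most
  \<open>2 Q + 2 \<sigma>\<^sub>k\<^sup>2\<close> in expectation, and the refreshing coins give
  \<open>E \<sigma>\<^sub>k\<^sub>+\<^sub>1\<^sup>2 = (1 - p) E \<sigma>\<^sub>k\<^sup>2 + p E Q\<close>. With the weight \<open>8 \<gamma>\<^sup>2 / p\<close> the coefficient of \<open>\<sigma>\<^sub>k\<^sup>2\<close>
  becomes \<open>(8 \<gamma>\<^sup>2 / p) (1 - p / 2)\<close>, which \<open>\<gamma> \<mu> \<le> p\<close> bounds by the required contraction; the
  coefficient of \<open>Q\<close> becomes \<open>12 \<gamma>\<^sup>2 - \<gamma> / L\<close>, which \<open>12 \<gamma> L \<le> 1\<close> makes nonpositive
  (\<open>expected_lyapunov_Suc_le\<close>).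

  Expectations that involve samples and coins are computed without conditional expectations of
  vectors: an event whose conditional probability given the past is a constant \<open>q\<close> contributes the
  factor \<open>q\<close> to the integral of every past-measurable integrand
  (\<open>integral_mult_indicator_cond_prob_const\<close>, \<open>integral_at_uniform_index\<close>). The conditional law of
  the aggregator output is turned into an iterated integral by \<open>nn_integral_cond_law\<close>.\<close>

text \<open>Index sets are intervals starting at \<open>1\<close>; the simplifier has to keep that bound.\<close>

declare One_nat_def [simp del]

section \<open>Smooth convex functions\<close>

lemma smooth_has_derivative:
  assumes "smooth L h"
  shows "(h has_derivative (\<lambda>v. v \<bullet> gradient h y)) (at y)"
  using GDERIV_gradient[of h y] assms by (simp add: smooth_def gderiv_def)

lemma smooth_continuous_on_gradient:
  assumes "smooth L h"
  shows "continuous_on S (gradient h)"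
proof -
  have "dist (gradient h y) (gradient h z) \<le> \<bar>L\<bar> * dist y z" for y z
  proof -
    have "norm (gradient h y - gradient h z) \<le> L * norm (y - z)"
      using assms by (simp add: smooth_def)
    also have "\<dots> \<le> \<bar>L\<bar> * norm (y - z)" by (intro mult_right_mono) auto
    finally show ?thesis by (simp add: dist_norm)
  qed
  then have "\<bar>L\<bar>-lipschitz_on S (gradient h)"
    by (intro lipschitz_onI) auto
  then show ?thesis by (rule lipschitz_on_continuous_on)
qed

text \<open>The quadratic upper bound minus \<open>h\<close>, restricted to the segment from \<open>y\<close> to \<open>z\<close>, has a
  nonnegative derivative because the gradient is Lipschitz. Integrating the Lipschitz bound in this
  way, instead of using it at one point, is what produces the sharp constant \<open>L / 2\<close>.\<close>

lemma smooth_upper_bound: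
  assumes "smooth L h"
  shows "h z \<le> h y + gradient h y \<bullet> (z - y) + L / 2 * (norm (z - y))\<^sup>2"
proof -
  define v where "v = z - y"
  define \<phi> where "\<phi> t = h (y + t *\<^sub>R v) - t * (gradient h y \<bullet> v) - L / 2 * t\<^sup>2 * (norm v)\<^sup>2"
    for t :: real
  define \<phi>' where "\<phi>' t = v \<bullet> gradient h (y + t *\<^sub>R v) - gradient h y \<bullet> v - L * t * (norm v)\<^sup>2"
    for t
  have line: "((\<lambda>t. h (y + t *\<^sub>R v)) has_derivative (\<lambda>s. (s *\<^sub>R v) \<bullet> gradient h (y + t *\<^sub>R v))) (at t)"
    for t :: real
    by (rule has_derivative_compose[OF _ smooth_has_derivative[OF assms], of "\<lambda>t. y + t *\<^sub>R v"])
      (auto intro!: derivative_eq_intros)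
  have "(\<phi> has_real_derivative \<phi>' t) (at t)" for t
  proof -
    have "((\<lambda>t. h (y + t *\<^sub>R v)) has_real_derivative (v \<bullet> gradient h (y + t *\<^sub>R v))) (at t)"
      using line[of t] by (simp add: has_field_derivative_def mult.commute[of _ "v \<bullet> _"] mult_commute_abs)
    then show ?thesis
      unfolding \<phi>_def \<phi>'_def by (auto intro!: derivative_eq_intros)
  qed
  moreover have "\<phi>' t \<le> 0" if "0 \<le> t" "t \<le> 1" for t
  proof -
    have "v \<bullet> (gradient h (y + t *\<^sub>R v) - gradient h y)
        \<le> norm v * norm (gradient h (y + t *\<^sub>R v) - gradient h y)"
      by (rule norm_cauchy_schwarz)
    also have "\<dots> \<le> norm v * (L * norm (y + t *\<^sub>R v - y))"
      using assms unfolding smooth_def by (intro mult_left_mono) (blast, simp)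
    also have "\<dots> = L * t * (norm v)\<^sup>2" using that by (simp add: power2_eq_square)
    finally show ?thesis by (simp add: \<phi>'_def inner_diff_right inner_commute)
  qed
  ultimately have "\<phi> 1 \<le> \<phi> 0"
    by (intro DERIV_nonpos_imp_nonincreasing[of 0 1 \<phi>]) (auto intro!: exI)
  then show ?thesis by (simp add: \<phi>_def v_def algebra_simps)
qed

text \<open>By convexity \<open>h\<close> lies above its tangent at \<open>y\<close> at every point, in particular at the point that
  a gradient step of length \<open>1 / L\<close> for the difference of \<open>h\<close> and that tangent reaches from \<open>z\<close>;
  by smoothness this step lowers the difference by at least
  \<open>(norm (gradient h z - gradient h y))\<^sup>2 / (2 * L)\<close>.\<close>

lemma smooth_convex_gradient_diff_le:
  assumes "smooth L h" "0 < L" and conv: "\<And>y z. h z \<ge> h y + gradient h y \<bullet> (z - y)"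
  shows "(norm (gradient h z - gradient h y))\<^sup>2 \<le> 2 * L * (h z - h y - gradient h y \<bullet> (z - y))"
proof -
  define d where "d = gradient h z - gradient h y"
  define u where "u = z - (1 / L) *\<^sub>R d"
  have "h y + gradient h y \<bullet> (u - y) \<le> h z + gradient h z \<bullet> (u - z) + L / 2 * (norm (u - z))\<^sup>2"
    using conv[of y u] smooth_upper_bound[OF assms(1), of u z] by linarith
  also have "L / 2 * (norm (u - z))\<^sup>2 = (norm d)\<^sup>2 / (2 * L)"
    using assms(2) by (simp add: u_def power_mult_distrib power_divide power2_eq_square)
  also have "gradient h z \<bullet> (u - z) = gradient h y \<bullet> (u - z) - (norm d)\<^sup>2 / L"
    using assms(2) by (simp add: u_def d_def power2_norm_eq_inner algebra_simps diff_divide_distrib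
        add_divide_distrib inner_commute)
  finally have "(norm d)\<^sup>2 / (2 * L) \<le> h z - h y - gradient h y \<bullet> (z - y)"
    by (simp add: inner_diff_right field_simps)
  then show ?thesis using assms(2) by (simp add: d_def field_simps)
qed

lemma gradient_minimizer_eq_0:
  assumes "h differentiable (at y)" "\<And>z. h y \<le> h z"
  shows "gradient h y = 0"
proof -
  have "(h has_derivative (\<lambda>v. v \<bullet> gradient h y)) (at y)"
    using GDERIV_gradient[OF assms(1)] by (simp add: gderiv_def)
  then have "(\<lambda>v. v \<bullet> gradient h y) = (\<lambda>v. 0)"
    using assms(2) by (intro has_derivative_local_min) (auto simp: eventually_at_filter)
  then show ?thesis by (metis inner_eq_zero_iff)
qed

section \<open>Averages and norms\<close>

lemma norm_add_sq_le: "(norm (a + b))\<^sup>2 \<le> 2 * (norm a)\<^sup>2 + 2 * (norm (b :: 'v::real_inner))\<^sup>2"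
proof -
  have "0 \<le> (norm (a - b))\<^sup>2" by simp
  then show ?thesis by (simp add: power2_norm_eq_inner inner_simps inner_commute)
qed

lemma norm_diff_sq_le: "(norm (a - b))\<^sup>2 \<le> 2 * (norm a)\<^sup>2 + 2 * (norm (b :: 'v::real_inner))\<^sup>2"
  using norm_add_sq_le[of a "- b"] by simp

text \<open>Young's inequality splits the inner product of the perturbation \<open>e\<close> with \<open>d\<close>; the weight
  \<open>\<mu> / 2\<close> is what leaves half of the contraction given by strong convexity.\<close>

lemma norm_perturbed_step_sq_le:
  fixes d h e :: "'v::real_inner"
  assumes "0 < \<gamma>" "0 < \<mu>"
  shows "(norm (d - \<gamma> *\<^sub>R (h + e)))\<^sup>2 \<le> (1 + \<gamma> * \<mu> / 2) * (norm d)\<^sup>2 - 2 * \<gamma> * (h \<bullet> d)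
    + 2 * \<gamma>\<^sup>2 * (norm h)\<^sup>2 + (2 * \<gamma> / \<mu> + 2 * \<gamma>\<^sup>2) * (norm e)\<^sup>2"
proof -
  have "(norm (d - \<gamma> *\<^sub>R (h + e)))\<^sup>2
      = (norm d)\<^sup>2 - 2 * \<gamma> * (h \<bullet> d) - 2 * \<gamma> * (e \<bullet> d) + \<gamma>\<^sup>2 * (norm (h + e))\<^sup>2"
    unfolding power2_norm_eq_inner by (simp add: algebra_simps inner_commute power2_eq_square)
  moreover have "\<gamma>\<^sup>2 * (norm (h + e))\<^sup>2 \<le> \<gamma>\<^sup>2 * (2 * (norm h)\<^sup>2 + 2 * (norm e)\<^sup>2)"
    by (intro mult_left_mono norm_add_sq_le) auto
  moreover have "0 \<le> 2 * \<gamma> / \<mu> * (norm (e + (\<mu> / 2) *\<^sub>R d))\<^sup>2"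
    using assms by simp
  moreover have "2 * \<gamma> / \<mu> * (norm (e + (\<mu> / 2) *\<^sub>R d))\<^sup>2
      = 2 * \<gamma> / \<mu> * (norm e)\<^sup>2 + 2 * \<gamma> * (e \<bullet> d) + \<gamma> * \<mu> / 2 * (norm d)\<^sup>2"
    using assms unfolding power2_norm_eq_inner
    by (simp add: inner_add_left inner_add_right inner_commute field_simps)
  ultimately show ?thesis by (simp add: algebra_simps)
qed

lemma average_diff: "average I (\<lambda>i. u i - v i) = average I u - average I v"
  by (simp add: average_def sum_subtractf scaleR_diff_right)

lemma average_add_const:
  "finite I \<Longrightarrow> I \<noteq> {} \<Longrightarrow> average I (\<lambda>i. v i + a) = average I v + a"
  by (simp add: average_def sum.distrib scaleR_add_right sum_constant_scaleR)

lemma average_diff_const: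
  "finite I \<Longrightarrow> I \<noteq> {} \<Longrightarrow> average I (\<lambda>i. v i - a) = average I v - a"
  using average_add_const[of I v "- a"] by simp

lemma average_inner_left: "average I v \<bullet> a = average I (\<lambda>i. v i \<bullet> (a :: 'v::real_inner))"
  by (simp add: average_def inner_sum_left sum_divide_distrib)

lemma average_mono:
  "(\<And>i. i \<in> I \<Longrightarrow> u i \<le> v i) \<Longrightarrow> average I u \<le> (average I v :: real)"
  unfolding average_def by (auto intro!: divide_right_mono sum_mono)

lemma average_const: "finite I \<Longrightarrow> I \<noteq> {} \<Longrightarrow> average I (\<lambda>i. a) = (a :: real)"
  by (simp add: average_def)

lemma average_add: "average I (\<lambda>i. u i + v i) = average I u + average I v"
  by (simp add: average_def sum.distrib scaleR_add_right)

lemma average_mult_left: "average I (\<lambda>i. a * u i) = a * (average I u :: real)"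
  by (simp add: average_def sum_distrib_left)

lemma average_norm_sq_diff_average:
  fixes v :: "nat \<Rightarrow> 'v::real_inner"
  assumes "finite I" "I \<noteq> {}"
  shows "average I (\<lambda>i. (norm (v i - average I v))\<^sup>2)
    = average I (\<lambda>i. (norm (v i))\<^sup>2) - (norm (average I v))\<^sup>2"
proof -
  have "average I (\<lambda>i. (norm (v i - average I v))\<^sup>2)
      = average I (\<lambda>i. (norm (v i))\<^sup>2 - 2 * (v i \<bullet> average I v) + (norm (average I v))\<^sup>2)"
    by (intro arg_cong[of _ _ "average I"] ext)
      (simp add: power2_norm_eq_inner inner_simps inner_commute)
  also have "\<dots> = average I (\<lambda>i. (norm (v i))\<^sup>2) - 2 * (average I v \<bullet> average I v)
      + (norm (average I v))\<^sup>2"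
    unfolding average_add_const[OF assms] average_diff average_mult_left average_inner_left[of I v] ..
  finally show ?thesis by (simp add: power2_norm_eq_inner)
qed

lemma average_nonneg: "(\<And>i. i \<in> I \<Longrightarrow> 0 \<le> u i) \<Longrightarrow> 0 \<le> (average I u :: real)"
  unfolding average_def by (auto intro!: divide_nonneg_nonneg sum_nonneg)

lemma norm_average_sq_le:
  fixes v :: "nat \<Rightarrow> 'v::real_inner"
  assumes "finite I" "I \<noteq> {}"
  shows "(norm (average I v))\<^sup>2 \<le> average I (\<lambda>i. (norm (v i))\<^sup>2)"
  using average_norm_sq_diff_average[OF assms, of v]
    average_nonneg[of I "\<lambda>i. (norm (v i - average I v))\<^sup>2"] by simp

section \<open>Finite sums of smooth convex functions\<close>

locale finite_sum_problem =
  fixes m :: nat and f :: "nat \<Rightarrow> 'v::euclidean_space \<Rightarrow> real" and L \<mu> \<sigma> :: real and xs :: 'v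
  assumes components: "1 \<le> m"
    and L_pos: "0 < L"
    and smooth_component: "\<And>j. j \<in> {1..m} \<Longrightarrow> smooth L (f j)"
    and convex_component: "\<And>j y z. j \<in> {1..m} \<Longrightarrow> f j z \<ge> f j y + gradient (f j) y \<bullet> (z - y)"
    and mu_pos: "0 < \<mu>"
    and strongly_convex: "\<And>y z. objective m f z \<ge>
      objective m f y + gradient (objective m f) y \<bullet> (z - y) + \<mu> / 2 * (norm (z - y))\<^sup>2"
    and minimizer: "\<And>y. objective m f xs \<le> objective m f y"
    and bounded_variance: "\<And>y. measure_pmf.expectation (pmf_of_set {1..m})
      (\<lambda>j. (norm (gradient (f j) y - gradient (objective m f) y))\<^sup>2) \<le> \<sigma>\<^sup>2"
begin

abbreviation "full_gradient \<equiv> gradient (objective m f)"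

text \<open>The function that the reference error averages over the reference points. It also measures the
  progress at the iterate itself, and so lets the analysis do without function values.\<close>

definition gradient_gap :: "'v \<Rightarrow> real" where
  "gradient_gap y = average {1..m} (\<lambda>j. (norm (gradient (f j) y - gradient (f j) xs))\<^sup>2)"

lemma indices_nonempty: "finite {1..m}" "{1..m} \<noteq> {}"
  using components by auto

lemma objective_has_derivative:
  "(objective m f has_derivative (\<lambda>v. v \<bullet> average {1..m} (\<lambda>j. gradient (f j) y))) (at y)"
proof -
  have "((\<lambda>z. (1 / real m) * (\<Sum>j=1..m. f j z)) has_derivative
      (\<lambda>v. (1 / real m) * (\<Sum>j=1..m. v \<bullet> gradient (f j) y))) (at y)"
    by (intro has_derivative_mult_right has_derivative_sum smooth_has_derivative[OF smooth_component])
  then show ?thesis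
    by (simp add: objective_def[abs_def] average_def inner_sum_right)
qed

lemma full_gradient_eq_average: "full_gradient y = average {1..m} (\<lambda>j. gradient (f j) y)"
  by (intro gradient_eqI) (use objective_has_derivative in \<open>simp add: gderiv_def\<close>)

lemma full_gradient_minimizer: "full_gradient xs = 0"
  using objective_has_derivative minimizer
  by (intro gradient_minimizer_eq_0) (auto simp: differentiable_def)

lemma borel_measurable_gradient:
  assumes "j \<in> {1..m}"
  shows "gradient (f j) \<in> borel_measurable borel"
  using smooth_continuous_on_gradient[OF smooth_component[OF assms]]
  by (intro borel_measurable_continuous_onI)

lemma borel_measurable_full_gradient: "full_gradient \<in> borel_measurable borel"
proof -
  have "(\<lambda>y. average {1..m} (\<lambda>j. gradient (f j) y)) \<in> borel_measurable borel"
    unfolding average_def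
    by (intro borel_measurable_scaleR borel_measurable_sum borel_measurable_gradient) auto
  then show ?thesis by (simp add: full_gradient_eq_average[abs_def])
qed

lemma norm_gradient_diff_le:
  "j \<in> {1..m} \<Longrightarrow> norm (gradient (f j) y - gradient (f j) z) \<le> L * norm (y - z)"
  using smooth_component by (simp add: smooth_def)

lemma variance_le: "average {1..m} (\<lambda>j. (norm (gradient (f j) y - full_gradient y))\<^sup>2) \<le> \<sigma>\<^sup>2"
  using bounded_variance[of y] indices_nonempty
  by (simp add: integral_pmf_of_set average_def)

lemma gradient_gap_nonneg: "0 \<le> gradient_gap y"
  unfolding gradient_gap_def by (intro average_nonneg) simp

text \<open>The gradient gap is at most \<open>2 * L\<close> times the suboptimality, because the linear terms of the
  components cancel at the minimizer; and strong convexity bounds the suboptimality by the inner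
  product.\<close>

lemma full_gradient_inner_ge:
  "full_gradient y \<bullet> (y - xs) \<ge> gradient_gap y / (2 * L) + \<mu> / 2 * (norm (y - xs))\<^sup>2"
proof -
  have "gradient_gap y \<le> average {1..m} (\<lambda>j. 2 * L * (f j y - f j xs - gradient (f j) xs \<bullet> (y - xs)))"
    unfolding gradient_gap_def
    by (intro average_mono smooth_convex_gradient_diff_le smooth_component L_pos convex_component)
  also have "\<dots> = 2 * L * (average {1..m} (\<lambda>j. f j y) - average {1..m} (\<lambda>j. f j xs)
      - average {1..m} (\<lambda>j. gradient (f j) xs) \<bullet> (y - xs))"
    by (simp add: average_mult_left average_diff average_inner_left)
  also have "\<dots> = 2 * L * (objective m f y - objective m f xs)"
    using full_gradient_minimizer unfolding full_gradient_eq_average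
    by (simp add: objective_def) (simp add: average_def)
  finally have "gradient_gap y / (2 * L) \<le> objective m f y - objective m f xs"
    using L_pos by (simp add: field_simps)
  moreover have "full_gradient y \<bullet> (y - xs) \<ge> objective m f y - objective m f xs
      + \<mu> / 2 * (norm (y - xs))\<^sup>2"
    using strongly_convex[of y xs] by (simp add: inner_diff_right norm_minus_commute)
  ultimately show ?thesis by linarith
qed

text \<open>The gradient of component \<open>j\<close> at \<open>y\<close>, with its value at \<open>r\<close> as a control variate: this leaves the
  mean over \<open>j\<close> unchanged and makes the variance small when \<open>y\<close> and \<open>r\<close> are close.\<close>

definition svrg_estimate :: "'v \<Rightarrow> 'v \<Rightarrow> nat \<Rightarrow> 'v" where
  "svrg_estimate y r j = gradient (f j) y - gradient (f j) r + full_gradient r"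

lemma average_svrg_estimate: "average {1..m} (\<lambda>j. svrg_estimate y r j) = full_gradient y"
  unfolding svrg_estimate_def average_add_const[OF indices_nonempty] average_diff
  by (simp flip: full_gradient_eq_average)

text \<open>The estimate is the difference of the deviations of a component gradient from its value at
  the minimizer, taken at \<open>y\<close> and at \<open>r\<close>, where the second deviation is centred; centring does not
  increase the second moment.\<close>

lemma svrg_estimate_second_moment_le:
  "average {1..m} (\<lambda>j. (norm (svrg_estimate y r j))\<^sup>2) \<le> 2 * gradient_gap y + 2 * gradient_gap r"
proof -
  define u where "u j = gradient (f j) r - gradient (f j) xs" for j
  have u: "average {1..m} u = full_gradient r"
    using full_gradient_minimizer unfolding u_def average_diff full_gradient_eq_average by simp
  have "average {1..m} (\<lambda>j. (norm (svrg_estimate y r j))\<^sup>2)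
      \<le> average {1..m} (\<lambda>j. 2 * (norm (gradient (f j) y - gradient (f j) xs))\<^sup>2
          + 2 * (norm (u j - average {1..m} u))\<^sup>2)"
  proof (intro average_mono)
    fix j
    have "svrg_estimate y r j = (gradient (f j) y - gradient (f j) xs) - (u j - average {1..m} u)"
      by (simp add: svrg_estimate_def u) (simp add: u_def)
    then show "(norm (svrg_estimate y r j))\<^sup>2 \<le> 2 * (norm (gradient (f j) y - gradient (f j) xs))\<^sup>2
        + 2 * (norm (u j - average {1..m} u))\<^sup>2"
      by (simp only: norm_diff_sq_le)
  qed
  also have "\<dots> = 2 * gradient_gap y + 2 * average {1..m} (\<lambda>j. (norm (u j - average {1..m} u))\<^sup>2)"
    by (simp add: average_add average_mult_left gradient_gap_def)
  also have "average {1..m} (\<lambda>j. (norm (u j - average {1..m} u))\<^sup>2) \<le> gradient_gap r"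
    using average_norm_sq_diff_average[OF indices_nonempty, of u] by (simp add: gradient_gap_def u_def)
  finally show ?thesis by simp
qed

text \<open>This bound depends neither on \<open>y\<close> nor on \<open>r\<close>: the deviation is the difference of the centred
  gradients of a component at the two points, and each of them has second moment at most
  \<open>\<sigma>\<^sup>2\<close>.\<close>

lemma svrg_estimate_variance_le:
  "average {1..m} (\<lambda>j. (norm (svrg_estimate y r j - full_gradient y))\<^sup>2) \<le> 4 * \<sigma>\<^sup>2"
proof -
  have "average {1..m} (\<lambda>j. (norm (svrg_estimate y r j - full_gradient y))\<^sup>2)
      \<le> average {1..m} (\<lambda>j. 2 * (norm (gradient (f j) y - full_gradient y))\<^sup>2
          + 2 * (norm (gradient (f j) r - full_gradient r))\<^sup>2)"
  proof (intro average_mono)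
    fix j
    have "svrg_estimate y r j - full_gradient y
        = (gradient (f j) y - full_gradient y) - (gradient (f j) r - full_gradient r)"
      by (simp add: svrg_estimate_def)
    then show "(norm (svrg_estimate y r j - full_gradient y))\<^sup>2
        \<le> 2 * (norm (gradient (f j) y - full_gradient y))\<^sup>2
          + 2 * (norm (gradient (f j) r - full_gradient r))\<^sup>2"
      by (simp only: norm_diff_sq_le)
  qed
  also have "\<dots> \<le> 4 * \<sigma>\<^sup>2"
    using variance_le[of y] variance_le[of r] by (simp add: average_add average_mult_left)
  finally show ?thesis .
qed

end

section \<open>Square-integrable random vectors\<close>

definition square_integrable :: "'a measure \<Rightarrow> ('a \<Rightarrow> 'v::euclidean_space) \<Rightarrow> bool" where
  "square_integrable M X \<longleftrightarrow> X \<in> borel_measurable M \<and> integrable M (\<lambda>\<omega>. (norm (X \<omega>))\<^sup>2)"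

lemma square_integrable_dominated:
  assumes "square_integrable M Y" "X \<in> borel_measurable M"
    and "AE \<omega> in M. norm (X \<omega>) \<le> a * norm (Y \<omega>)"
  shows "square_integrable M X"
proof -
  have "integrable M (\<lambda>\<omega>. a\<^sup>2 * (norm (Y \<omega>))\<^sup>2)"
    using assms(1) by (simp add: square_integrable_def)
  then have "integrable M (\<lambda>\<omega>. (norm (X \<omega>))\<^sup>2)"
  proof (rule Bochner_Integration.integrable_bound)
    show "AE \<omega> in M. norm ((norm (X \<omega>))\<^sup>2) \<le> norm (a\<^sup>2 * (norm (Y \<omega>))\<^sup>2)"
      using assms(3)
    proof eventually_elim
      case (elim \<omega>)
      then have "(norm (X \<omega>))\<^sup>2 \<le> (a * norm (Y \<omega>))\<^sup>2" by (intro power_mono) auto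
      then show ?case by (simp add: power_mult_distrib)
    qed
  qed (use assms(2) in measurable)
  with assms(2) show ?thesis by (simp add: square_integrable_def)
qed

lemma square_integrable_cong_AE:
  assumes "square_integrable M Y" "X \<in> borel_measurable M" "AE \<omega> in M. X \<omega> = Y \<omega>"
  shows "square_integrable M X"
  by (rule square_integrable_dominated[OF assms(1,2), of 1]) (use assms(3) in auto)

lemma square_integrable_scaleR:
  "square_integrable M X \<Longrightarrow> square_integrable M (\<lambda>\<omega>. a *\<^sub>R X \<omega>)"
  by (auto simp: square_integrable_def power_mult_distrib)

lemma square_integrable_add:
  assumes "square_integrable M X" "square_integrable M Y"
  shows "square_integrable M (\<lambda>\<omega>. X \<omega> + Y \<omega>)"
proof -
  have [measurable]: "X \<in> borel_measurable M" "Y \<in> borel_measurable M"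
    using assms by (auto simp: square_integrable_def)
  have "integrable M (\<lambda>\<omega>. 2 * (norm (X \<omega>))\<^sup>2 + 2 * (norm (Y \<omega>))\<^sup>2)"
    using assms by (simp add: square_integrable_def)
  then have "integrable M (\<lambda>\<omega>. (norm (X \<omega> + Y \<omega>))\<^sup>2)"
    by (rule Bochner_Integration.integrable_bound) (auto intro!: AE_I2 norm_add_sq_le)
  then show ?thesis by (simp add: square_integrable_def)
qed

lemma square_integrable_diff:
  assumes "square_integrable M X" "square_integrable M Y"
  shows "square_integrable M (\<lambda>\<omega>. X \<omega> - Y \<omega>)"
  using square_integrable_add[OF assms(1) square_integrable_scaleR[OF assms(2), of "-1"]] by simp

lemma square_integrable_zero: "square_integrable M (\<lambda>\<omega>. 0)"
  by (simp add: square_integrable_def)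

lemma square_integrable_sum:
  assumes "\<And>i. i \<in> I \<Longrightarrow> square_integrable M (X i)"
  shows "square_integrable M (\<lambda>\<omega>. \<Sum>i\<in>I. X i \<omega>)"
  using assms by (induction I rule: infinite_finite_induct)
    (auto intro: square_integrable_zero square_integrable_add)

lemma square_integrable_average:
  assumes "\<And>i. i \<in> I \<Longrightarrow> square_integrable M (X i)"
  shows "square_integrable M (\<lambda>\<omega>. average I (\<lambda>i. X i \<omega>))"
  unfolding average_def by (intro square_integrable_scaleR square_integrable_sum assms)

lemma (in finite_measure) square_integrable_const: "square_integrable M (\<lambda>\<omega>. a)"
  by (simp add: square_integrable_def)

lemma square_integrable_inner:
  assumes "square_integrable M X" "square_integrable M Y"
  shows "integrable M (\<lambda>\<omega>. X \<omega> \<bullet> Y \<omega>)"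
proof -
  have [measurable]: "X \<in> borel_measurable M" "Y \<in> borel_measurable M"
    using assms by (auto simp: square_integrable_def)
  have "integrable M (\<lambda>\<omega>. (norm (X \<omega>))\<^sup>2 + (norm (Y \<omega>))\<^sup>2)"
    using assms by (simp add: square_integrable_def)
  then show ?thesis
  proof (rule Bochner_Integration.integrable_bound)
    have "\<bar>X \<omega> \<bullet> Y \<omega>\<bar> \<le> (norm (X \<omega>))\<^sup>2 + (norm (Y \<omega>))\<^sup>2" for \<omega>
    proof -
      have "2 * (norm (X \<omega>) * norm (Y \<omega>)) \<le> (norm (X \<omega>))\<^sup>2 + (norm (Y \<omega>))\<^sup>2"
        using sum_squares_bound[of "norm (X \<omega>)" "norm (Y \<omega>)"] by simp
      moreover have "0 \<le> norm (X \<omega>) * norm (Y \<omega>)" by simp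
      ultimately show ?thesis using Cauchy_Schwarz_ineq2[of "X \<omega>" "Y \<omega>"] by linarith
    qed
    then show "AE \<omega> in M. norm (X \<omega> \<bullet> Y \<omega>) \<le> norm ((norm (X \<omega>))\<^sup>2 + (norm (Y \<omega>))\<^sup>2)"
      by auto
  qed measurable
qed

text \<open>Independent centred noises are used only through their pairwise orthogonality.\<close>

lemma integral_norm_sq_sum_orthogonal:
  assumes sq: "\<And>i. i \<in> I \<Longrightarrow> square_integrable M (X i)"
    and orth: "\<And>i l. i \<in> I \<Longrightarrow> l \<in> I \<Longrightarrow> i \<noteq> l \<Longrightarrow> (\<integral>\<omega>. X i \<omega> \<bullet> X l \<omega> \<partial>M) = 0"
    and "finite I"
  shows "(\<integral>\<omega>. (norm (\<Sum>i\<in>I. X i \<omega>))\<^sup>2 \<partial>M) = (\<Sum>i\<in>I. \<integral>\<omega>. (norm (X i \<omega>))\<^sup>2 \<partial>M)"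
proof -
  have "(\<integral>\<omega>. (norm (\<Sum>i\<in>I. X i \<omega>))\<^sup>2 \<partial>M) = (\<integral>\<omega>. (\<Sum>i\<in>I. \<Sum>l\<in>I. X l \<omega> \<bullet> X i \<omega>) \<partial>M)"
    by (simp add: power2_norm_eq_inner inner_sum_left inner_sum_right)
  also have "\<dots> = (\<Sum>i\<in>I. \<Sum>l\<in>I. \<integral>\<omega>. X l \<omega> \<bullet> X i \<omega> \<partial>M)"
    by (simp add: square_integrable_inner sq)
  also have "\<dots> = (\<Sum>i\<in>I. \<Sum>l\<in>I. if l = i then \<integral>\<omega>. (norm (X i \<omega>))\<^sup>2 \<partial>M else 0)"
    by (intro sum.cong refl) (auto simp: orth power2_norm_eq_inner)
  finally show ?thesis using \<open>finite I\<close> by simp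
qed

section \<open>Conditioning on a sub-sigma-algebra\<close>

text \<open>Since \<open>F\<close> is measurable for the sub-sigma-algebra, the indicator may be replaced by its conditional
  expectation, which is the constant \<open>q\<close>. Coins and samples both enter through this rule.\<close>

lemma (in finite_measure) integral_mult_indicator_cond_prob_const:
  assumes "subalgebra M N" "B \<in> sets M"
    and cond: "AE \<omega> in M. real_cond_exp M N (indicator B) \<omega> = q"
    and F: "F \<in> borel_measurable N" "integrable M F"
  shows "(\<integral>\<omega>. F \<omega> * indicator B \<omega> \<partial>M) = q * (\<integral>\<omega>. F \<omega> \<partial>M)"
proof -
  interpret finite_measure_subalgebra M N using assms(1) by unfold_locales
  note [measurable] = assms(2) borel_measurable_integrable[OF F(2)]
  have int: "integrable M (\<lambda>\<omega>. F \<omega> * indicator B \<omega>)"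
    using integrable_mult_indicator[OF assms(2) F(2)] by (simp add: mult.commute)
  have "(\<integral>\<omega>. F \<omega> * indicator B \<omega> \<partial>M) = (\<integral>\<omega>. F \<omega> * real_cond_exp M N (indicator B) \<omega> \<partial>M)"
    by (rule real_cond_exp_intg(2)[symmetric]) (use int F in auto)
  also have "\<dots> = (\<integral>\<omega>. q * F \<omega> \<partial>M)"
    by (intro integral_cong_AE) (use cond in auto)
  finally show ?thesis by simp
qed

lemma (in finite_measure) real_cond_exp_indicator_eq_const:
  assumes "subalgebra M N" "B \<in> sets M"
    and indep: "\<And>C. C \<in> sets N \<Longrightarrow> measure M (B \<inter> C) = q * measure M C"
  shows "AE \<omega> in M. real_cond_exp M N (indicator B) \<omega> = q"
proof -
  interpret finite_measure_subalgebra M N using assms(1) by unfold_locales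
  show ?thesis
  proof (rule real_cond_exp_charact)
    fix C assume C: "C \<in> sets N"
    then have CM: "C \<in> sets M" using assms(1) by (auto simp: subalgebra_def)
    have "(\<integral>\<omega>\<in>C. indicator B \<omega> \<partial>M) = measure M (B \<inter> C)"
      using CM assms(2) by (simp add: set_lebesgue_integral_def indicator_inter_arith[symmetric] Int_commute)
    also have "\<dots> = (\<integral>\<omega>\<in>C. q \<partial>M)"
      using CM indep[OF C] by (simp add: set_lebesgue_integral_def mult.commute)
    finally show "(\<integral>\<omega>\<in>C. indicator B \<omega> \<partial>M) = (\<integral>\<omega>\<in>C. q \<partial>M)" .
  qed (use assms(2) in \<open>auto intro!: integrable_real_indicator simp: emeasure_eq_measure\<close>)
qed

text \<open>Splitting the integrand according to the value of the index \<open>J\<close> reduces the claim to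
  events of constant conditional probability. An arbitrary index type is needed because
  pairs of samples are treated as one index.\<close>

lemma (in finite_measure) integral_at_uniform_index:
  fixes F :: "'i \<Rightarrow> 'a \<Rightarrow> real"
  assumes sub: "subalgebra M N" and "finite T"
    and J: "\<And>\<omega>. \<omega> \<in> space M \<Longrightarrow> J \<omega> \<in> T" "\<And>j. j \<in> T \<Longrightarrow> {\<omega> \<in> space M. J \<omega> = j} \<in> sets M"
    and indep: "\<And>j C. j \<in> T \<Longrightarrow> C \<in> sets N \<Longrightarrow>
      measure M ({\<omega> \<in> space M. J \<omega> = j} \<inter> C) = q * measure M C"
    and F: "\<And>j. j \<in> T \<Longrightarrow> F j \<in> borel_measurable N" "\<And>j. j \<in> T \<Longrightarrow> integrable M (F j)"
  shows "integrable M (\<lambda>\<omega>. F (J \<omega>) \<omega>)"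
    and "(\<integral>\<omega>. F (J \<omega>) \<omega> \<partial>M) = q * (\<Sum>j\<in>T. \<integral>\<omega>. F j \<omega> \<partial>M)"
proof -
  let ?B = "\<lambda>j. {\<omega> \<in> space M. J \<omega> = j}"
  have eq: "F (J \<omega>) \<omega> = (\<Sum>j\<in>T. F j \<omega> * indicator (?B j) \<omega>)" if "\<omega> \<in> space M" for \<omega>
  proof -
    have "(\<Sum>j\<in>T. F j \<omega> * indicator (?B j) \<omega>) = (\<Sum>j\<in>T. if j = J \<omega> then F j \<omega> else 0)"
      using that by (intro sum.cong) (auto simp: indicator_def)
    then show ?thesis using J(1)[OF that] \<open>finite T\<close> by simp
  qed
  have int: "integrable M (\<lambda>\<omega>. F j \<omega> * indicator (?B j) \<omega>)" if "j \<in> T" for j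
    using integrable_mult_indicator[OF J(2) F(2), OF that that] by (simp add: mult.commute)
  show "integrable M (\<lambda>\<omega>. F (J \<omega>) \<omega>)"
    using int by (subst Bochner_Integration.integrable_cong[OF refl eq]) auto
  have "(\<integral>\<omega>. F (J \<omega>) \<omega> \<partial>M) = (\<integral>\<omega>. (\<Sum>j\<in>T. F j \<omega> * indicator (?B j) \<omega>) \<partial>M)"
    by (intro Bochner_Integration.integral_cong refl eq)
  also have "\<dots> = (\<Sum>j\<in>T. \<integral>\<omega>. F j \<omega> * indicator (?B j) \<omega> \<partial>M)"
    using int by simp
  also have "\<dots> = (\<Sum>j\<in>T. q * (\<integral>\<omega>. F j \<omega> \<partial>M))"
    by (intro sum.cong refl integral_mult_indicator_cond_prob_const[OF sub J(2)]
        real_cond_exp_indicator_eq_const[OF sub J(2)] indep F)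
  finally show "(\<integral>\<omega>. F (J \<omega>) \<omega> \<partial>M) = q * (\<Sum>j\<in>T. \<integral>\<omega>. F j \<omega> \<partial>M)"
    by (simp add: sum_distrib_left)
qed

text \<open>The hypothesis \<open>law\<close> fixes the conditional law one event at a time, with an exceptional null set
  for each event. This suffices: both sides are finite measures, and they agree on the measurable
  rectangles, which generate the product.\<close>

lemma (in prob_space) distr_pair_eq_bind_cond_law:
  assumes sub: "subalgebra M N" and X: "X \<in> N \<rightarrow>\<^sub>M S" and Y: "random_variable R Y"
    and K: "K \<in> S \<rightarrow>\<^sub>M prob_algebra R"
    and law: "\<And>D. D \<in> sets R \<Longrightarrow> AE \<omega> in M.
      real_cond_exp M N (indicator {\<omega> \<in> space M. Y \<omega> \<in> D}) \<omega> = measure (K (X \<omega>)) D"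
  shows "distr M (S \<Otimes>\<^sub>M R) (\<lambda>\<omega>. (X \<omega>, Y \<omega>)) = distr M S X \<bind> (\<lambda>v. distr (K v) (S \<Otimes>\<^sub>M R) (Pair v))"
    (is "?P = ?Q")
proof -
  interpret finite_measure_subalgebra M N using sub by unfold_locales
  have XM[measurable]: "X \<in> M \<rightarrow>\<^sub>M S" using X sub measurable_from_subalg by blast
  note [measurable] = Y
  have Ks: "K \<in> S \<rightarrow>\<^sub>M subprob_algebra R" by (rule measurable_prob_algebraD[OF K])
  define H where "H v = distr (K v) (S \<Otimes>\<^sub>M R) (Pair v)" for v
  have H: "H \<in> S \<rightarrow>\<^sub>M subprob_algebra (S \<Otimes>\<^sub>M R)"
    unfolding H_def by (rule measurable_distr2[OF _ Ks]) (simp add: case_prod_eta)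
  have ne: "space (distr M S X) \<noteq> {}"
    using measurable_space[OF XM] not_empty by auto
  have HD: "H \<in> distr M S X \<rightarrow>\<^sub>M subprob_algebra (S \<Otimes>\<^sub>M R)" using H by simp
  let ?E = "{a \<times> b | a b. a \<in> sets S \<and> b \<in> sets R}"
  have "?P = distr M S X \<bind> H"
  proof (rule measure_eqI_generator_eq[where E = ?E and \<Omega> = "space S \<times> space R"
        and A = "\<lambda>_. space S \<times> space R"])
    show "Int_stable ?E" by (rule Int_stable_pair_measure_generator)
    show "?E \<subseteq> Pow (space S \<times> space R)" by (rule pair_measure_closed)
    show "sets ?P = sigma_sets (space S \<times> space R) ?E" by (simp add: sets_pair_measure)
    show "sets (distr M S X \<bind> H) = sigma_sets (space S \<times> space R) ?E"
      using sets_bind_measurable[OF HD ne] by (simp add: sets_pair_measure)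
    show "range (\<lambda>_::nat. space S \<times> space R) \<subseteq> ?E" by auto
    show "(\<Union>i::nat. space S \<times> space R) = space S \<times> space R" by simp
    show "emeasure ?P (space S \<times> space R) \<noteq> \<infinity>"
    proof -
      interpret PP: prob_space ?P by (intro prob_space_distr) simp
      show ?thesis by simp
    qed
    fix Z assume "Z \<in> ?E"
    then obtain C D where Z: "Z = C \<times> D"
      and C[measurable]: "C \<in> sets S" and D[measurable]: "D \<in> sets R" by auto
    let ?Y = "{\<omega> \<in> space M. Y \<omega> \<in> D}" and ?X = "\<lambda>\<omega>. indicator C (X \<omega>) :: real"
    have XN: "?X \<in> borel_measurable N" using X C by measurable
    have probK: "prob_space (K (X \<omega>))" and setsK: "sets (K (X \<omega>)) = sets R" if "\<omega> \<in> space M" for \<omega>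
      using measurable_space[OF K measurable_space[OF XM that]] by (auto simp: space_prob_algebra)
    have int: "integrable M (\<lambda>\<omega>. ?X \<omega> * indicator ?Y \<omega>)"
      by (rule integrable_const_bound[where B = 1]) (auto simp: indicator_def)
    have "emeasure ?P Z = emeasure M {\<omega> \<in> space M. X \<omega> \<in> C \<and> Y \<omega> \<in> D}"
      unfolding Z by (subst emeasure_distr) (auto intro!: arg_cong[where f = "emeasure M"])
    also have "\<dots> = ennreal (\<integral>\<omega>. ?X \<omega> * indicator ?Y \<omega> \<partial>M)"
    proof -
      have "(\<integral>\<omega>. ?X \<omega> * indicator ?Y \<omega> \<partial>M) = (\<integral>\<omega>. indicator {\<omega> \<in> space M. X \<omega> \<in> C \<and> Y \<omega> \<in> D} \<omega> \<partial>M)"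
        by (intro Bochner_Integration.integral_cong) (auto simp: indicator_def)
      then show ?thesis by (simp add: emeasure_eq_measure)
    qed
    also have "(\<integral>\<omega>. ?X \<omega> * indicator ?Y \<omega> \<partial>M) = (\<integral>\<omega>. ?X \<omega> * real_cond_exp M N (indicator ?Y) \<omega> \<partial>M)"
      by (rule real_cond_exp_intg(2)[symmetric]) (use int XN in auto)
    also have "\<dots> = (\<integral>\<omega>. ?X \<omega> * measure (K (X \<omega>)) D \<partial>M)"
    proof (intro integral_cong_AE)
      show "(\<lambda>\<omega>. ?X \<omega> * measure (K (X \<omega>)) D) \<in> borel_measurable M"
        using measurable_compose[OF XM measurable_compose[OF Ks measurable_measure_subprob_algebra[OF D]]]
        by measurable
      show "AE \<omega> in M. ?X \<omega> * real_cond_exp M N (indicator ?Y) \<omega> = ?X \<omega> * measure (K (X \<omega>)) D"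
        using law[OF D] by auto
    qed measurable
    also have "ennreal \<dots> = (\<integral>\<^sup>+\<omega>. ennreal (?X \<omega> * measure (K (X \<omega>)) D) \<partial>M)"
    proof (rule nn_integral_eq_integral[symmetric])
      show "integrable M (\<lambda>\<omega>. ?X \<omega> * measure (K (X \<omega>)) D)"
      proof (rule integrable_const_bound[where B = 1])
        show "(\<lambda>\<omega>. ?X \<omega> * measure (K (X \<omega>)) D) \<in> borel_measurable M"
          using measurable_compose[OF XM measurable_compose[OF Ks measurable_measure_subprob_algebra[OF D]]]
          by measurable
        show "AE \<omega> in M. norm (?X \<omega> * measure (K (X \<omega>)) D) \<le> 1"
          using prob_space.prob_le_1[OF probK] by (auto simp: indicator_def)
      qed
    qed simp
    also have "\<dots> = (\<integral>\<^sup>+\<omega>. emeasure (H (X \<omega>)) Z \<partial>M)"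
    proof (intro nn_integral_cong)
      fix \<omega> assume \<omega>: "\<omega> \<in> space M"
      have XS: "X \<omega> \<in> space S" using measurable_space[OF XM \<omega>] .
      have "emeasure (H (X \<omega>)) Z = emeasure (K (X \<omega>)) (Pair (X \<omega>) -` Z \<inter> space (K (X \<omega>)))"
        unfolding H_def
      proof (rule emeasure_distr)
        show "Pair (X \<omega>) \<in> K (X \<omega>) \<rightarrow>\<^sub>M S \<Otimes>\<^sub>M R"
          using XS setsK[OF \<omega>] by (subst measurable_cong_sets[OF setsK[OF \<omega>] refl]) measurable
      qed (simp add: Z)
      also have "Pair (X \<omega>) -` Z \<inter> space (K (X \<omega>)) = (if X \<omega> \<in> C then D else {})"
        using sets.sets_into_space[OF D] sets_eq_imp_space_eq[OF setsK[OF \<omega>]] by (auto simp: Z)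
      finally show "ennreal (?X \<omega> * measure (K (X \<omega>)) D) = emeasure (H (X \<omega>)) Z"
        using finite_measure.emeasure_eq_measure[OF prob_space.finite_measure[OF probK[OF \<omega>]]]
        by simp
    qed
    also have "\<dots> = (\<integral>\<^sup>+v. emeasure (H v) Z \<partial>distr M S X)"
    proof (rule nn_integral_distr[symmetric, OF XM])
      show "(\<lambda>v. emeasure (H v) Z) \<in> borel_measurable (distr M S X)"
        by (rule measurable_compose[OF HD measurable_emeasure_subprob_algebra]) (simp add: Z)
    qed
    also have "\<dots> = emeasure (distr M S X \<bind> H) Z"
      by (rule emeasure_bind[symmetric, OF ne HD]) (simp add: Z)
    finally show "emeasure ?P Z = emeasure (distr M S X \<bind> H) Z" .
  qed
  then show ?thesis by (simp add: H_def[abs_def])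
qed

text \<open>This form makes the kernel integral in the definition of a robust aggregator, in which the input
  is held fixed while the output varies, an expectation over the actual run.\<close>

lemma (in prob_space) nn_integral_cond_law:
  assumes sub: "subalgebra M N" and X: "X \<in> N \<rightarrow>\<^sub>M S" and Y: "random_variable R Y"
    and K: "K \<in> S \<rightarrow>\<^sub>M prob_algebra R"
    and law: "\<And>D. D \<in> sets R \<Longrightarrow> AE \<omega> in M.
      real_cond_exp M N (indicator {\<omega> \<in> space M. Y \<omega> \<in> D}) \<omega> = measure (K (X \<omega>)) D"
    and h: "case_prod h \<in> borel_measurable (S \<Otimes>\<^sub>M R)"
  shows "(\<integral>\<^sup>+\<omega>. h (X \<omega>) (Y \<omega>) \<partial>M) = (\<integral>\<^sup>+\<omega>. \<integral>\<^sup>+y. h (X \<omega>) y \<partial>K (X \<omega>) \<partial>M)"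
proof -
  have XM[measurable]: "X \<in> M \<rightarrow>\<^sub>M S" using X sub measurable_from_subalg by blast
  note [measurable] = Y
  have Ks: "K \<in> S \<rightarrow>\<^sub>M subprob_algebra R" by (rule measurable_prob_algebraD[OF K])
  have H: "(\<lambda>v. distr (K v) (S \<Otimes>\<^sub>M R) (Pair v)) \<in> distr M S X \<rightarrow>\<^sub>M subprob_algebra (S \<Otimes>\<^sub>M R)"
    using measurable_distr2[OF _ Ks, of Pair] by (simp add: case_prod_eta)
  have "(\<integral>\<^sup>+\<omega>. h (X \<omega>) (Y \<omega>) \<partial>M) = (\<integral>\<^sup>+z. case_prod h z \<partial>distr M (S \<Otimes>\<^sub>M R) (\<lambda>\<omega>. (X \<omega>, Y \<omega>)))"
    using h by (subst nn_integral_distr) auto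
  also have "\<dots> = (\<integral>\<^sup>+v. \<integral>\<^sup>+z. case_prod h z \<partial>distr (K v) (S \<Otimes>\<^sub>M R) (Pair v) \<partial>distr M S X)"
    by (subst distr_pair_eq_bind_cond_law[OF sub X Y K law]) (simp_all only: nn_integral_bind[OF h H])
  also have "\<dots> = (\<integral>\<^sup>+v. \<integral>\<^sup>+y. h v y \<partial>K v \<partial>distr M S X)"
  proof (intro nn_integral_cong)
    fix v assume "v \<in> space (distr M S X)"
    then have v: "v \<in> space S" by simp
    have setsK: "sets (K v) = sets R"
      using measurable_space[OF K v] by (simp add: space_prob_algebra)
    have "Pair v \<in> K v \<rightarrow>\<^sub>M S \<Otimes>\<^sub>M R"
      using v by (subst measurable_cong_sets[OF setsK refl]) measurable
    then show "(\<integral>\<^sup>+z. case_prod h z \<partial>distr (K v) (S \<Otimes>\<^sub>M R) (Pair v)) = (\<integral>\<^sup>+y. h v y \<partial>K v)"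
      using h by (subst nn_integral_distr) auto
  qed
  also have "\<dots> = (\<integral>\<^sup>+\<omega>. \<integral>\<^sup>+y. h (X \<omega>) y \<partial>K (X \<omega>) \<partial>M)"
    using nn_integral_measurable_subprob_algebra2[OF h Ks] by (subst nn_integral_distr) auto
  finally show ?thesis .
qed

section \<open>Histories and samples\<close>

lemma generated_subset:
  assumes "space N = space M" "X \<in> N \<rightarrow>\<^sub>M S"
  shows "generated M S X \<subseteq> sets N"
  using assms by (simp add: generated_def measurable_iff_sets)

lemma measurable_generated:
  assumes "generated M S X \<subseteq> sets N" "space N = space M" "space S = UNIV"
  shows "X \<in> N \<rightarrow>\<^sub>M S"
  using assms by (simp add: generated_def measurable_iff_sets)

lemma generated_subset_Pow: "generated M S X \<subseteq> Pow (space M)"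
  using sets.space_closed[of "vimage_algebra (space M) X S"] by (simp add: generated_def)

lemma integrable_average:
  fixes F :: "nat \<Rightarrow> 'a \<Rightarrow> real"
  shows "(\<And>j. j \<in> I \<Longrightarrow> integrable M (F j)) \<Longrightarrow> integrable M (\<lambda>\<omega>. average I (\<lambda>j. F j \<omega>))"
  by (simp add: average_def)

lemma integral_average:
  fixes F :: "nat \<Rightarrow> 'a \<Rightarrow> real"
  shows "(\<And>j. j \<in> I \<Longrightarrow> integrable M (F j)) \<Longrightarrow>
    (\<integral>\<omega>. average I (\<lambda>j. F j \<omega>) \<partial>M) = average I (\<lambda>j. \<integral>\<omega>. F j \<omega> \<partial>M)"
  by (simp add: average_def)

lemma average_cong: "(\<And>i. i \<in> I \<Longrightarrow> u i = v i) \<Longrightarrow> average I u = average I v"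
  by (simp add: average_def)

locale br_lsvrg_run = br_lsvrg M n \<G> m f A \<gamma> b p x0 K x w g smp coin agg
    + finite_sum_problem m f L \<mu> \<sigma> xs
  for M :: "'\<omega> measure" and n :: nat and \<G> :: "nat set" and m :: nat
    and f :: "nat \<Rightarrow> 'v::euclidean_space \<Rightarrow> real" and A :: "(nat \<Rightarrow> 'v) \<Rightarrow> 'v measure"
    and \<gamma> :: real and b :: nat and p :: real and x0 :: 'v and K :: nat
    and x w g smp coin agg and L \<mu> \<sigma> :: real and xs :: 'v +
  fixes \<delta> c :: real
  assumes regular_subset: "\<G> \<subseteq> {1..n}"
    and delta_nonneg: "0 \<le> \<delta>"
    and regular: "(1 - \<delta>) * real n \<le> real (card \<G>)" "2 \<le> card \<G>"
    and c_pos: "0 < c"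
    and aggregator: "agnostic_robust_aggregator n \<delta> c A"
    and batch: "1 \<le> b"
    and prob: "0 < p" "p \<le> 1"
    and stepsize: "0 < \<gamma>" "\<gamma> \<le> 1 / (12 * L)" "\<gamma> \<le> p / \<mu>"
begin

abbreviation "history k \<equiv> past M n \<G> b smp coin g agg k"
abbreviation "message_history k \<equiv> past_and_messages M n \<G> b smp coin g agg k"

lemma regular_nonempty: "finite \<G>" "\<G> \<noteq> {}"
  using regular_subset finite_subset regular(2) by auto

lemma batch_nonempty: "finite {1..b}" "{1..b} \<noteq> {}"
  using batch by auto

lemma space_history: "space (history k) = space M"
  by (simp add: past_def space_measure_of_conv)

lemma space_message_history: "space (message_history k) = space M"
  by (simp add: past_and_messages_def space_measure_of_conv)

definition recorded :: "nat \<Rightarrow> '\<omega> set set" where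
  "recorded l =
     (\<Union>i\<in>\<G>. \<Union>t\<in>{1..b}. generated M (count_space UNIV) (smp l i t)) \<union>
     (\<Union>i\<in>\<G>. generated M (count_space UNIV) (coin l i)) \<union>
     (\<Union>i\<in>{1..n}. generated M borel (g l i)) \<union>
     generated M borel (agg l)"

lemma recorded_subset_Pow: "recorded l \<subseteq> Pow (space M)"
  unfolding recorded_def by (intro Un_least UN_least generated_subset_Pow)

lemma sets_history: "sets (history k) = sigma_sets (space M) (\<Union>l<k. recorded l)"
  unfolding past_def recorded_def[symmetric]
  by (intro sets_measure_of UN_least recorded_subset_Pow)

lemma history_leI:
  assumes N: "space N = space M"
    and "\<And>l i t. l < k \<Longrightarrow> i \<in> \<G> \<Longrightarrow> t \<in> {1..b} \<Longrightarrow> smp l i t \<in> N \<rightarrow>\<^sub>M count_space UNIV"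
    and "\<And>l i. l < k \<Longrightarrow> i \<in> \<G> \<Longrightarrow> coin l i \<in> N \<rightarrow>\<^sub>M count_space UNIV"
    and "\<And>l i. l < k \<Longrightarrow> i \<in> {1..n} \<Longrightarrow> g l i \<in> borel_measurable N"
    and "\<And>l. l < k \<Longrightarrow> agg l \<in> borel_measurable N"
  shows "sets (history k) \<subseteq> sets N"
proof -
  have "recorded l \<subseteq> sets N" if "l < k" for l
    unfolding recorded_def using assms(2-5)[OF that]
    by (intro Un_least UN_least generated_subset[OF N]) auto
  then show ?thesis
    unfolding sets_history N[symmetric] by (intro sets.sigma_sets_subset UN_least) auto
qed

lemma
  assumes "l < k"
  shows smp_history: "i \<in> \<G> \<Longrightarrow> t \<in> {1..b} \<Longrightarrow> smp l i t \<in> history k \<rightarrow>\<^sub>M count_space UNIV"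
    and coin_history: "i \<in> \<G> \<Longrightarrow> coin l i \<in> history k \<rightarrow>\<^sub>M count_space UNIV"
    and message_history: "i \<in> {1..n} \<Longrightarrow> g l i \<in> borel_measurable (history k)"
    and agg_history: "agg l \<in> borel_measurable (history k)"
proof -
  have "(\<Union>l<k. recorded l) \<subseteq> sets (history k)"
    unfolding sets_history by (rule sigma_sets_superset_generator)
  then have recorded: "recorded l \<subseteq> sets (history k)" using assms by blast
  note meas = measurable_generated[OF subset_trans[OF _ recorded] space_history]
  show "i \<in> \<G> \<Longrightarrow> t \<in> {1..b} \<Longrightarrow> smp l i t \<in> history k \<rightarrow>\<^sub>M count_space UNIV"
    by (rule meas) (unfold recorded_def, blast, simp)
  show "i \<in> \<G> \<Longrightarrow> coin l i \<in> history k \<rightarrow>\<^sub>M count_space UNIV"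
    by (rule meas) (unfold recorded_def, blast, simp)
  show "i \<in> {1..n} \<Longrightarrow> g l i \<in> borel_measurable (history k)"
    by (rule meas) (unfold recorded_def, blast, simp)
  show "agg l \<in> borel_measurable (history k)"
    by (rule meas) (unfold recorded_def, blast, simp)
qed

lemma subalgebra_history:
  assumes "k \<le> K"
  shows "subalgebra M (history k)"
proof -
  have "sets (history k) \<subseteq> sets M"
    using assms smp_uniform coin_random g_random agg_random by (intro history_leI) auto
  then show ?thesis by (simp add: subalgebra_def space_history)
qed

lemma history_mono:
  assumes "k \<le> l"
  shows "sets (history k) \<subseteq> sets (history l)"
  using assms smp_history coin_history message_history agg_history
  by (intro history_leI) (auto simp: space_history)

lemma sets_message_history:
  "sets (message_history k) = sigma_sets (space M)
     (sets (history k) \<union> (\<Union>i\<in>{1..n}. generated M borel (g k i)))"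
  unfolding past_and_messages_def
  by (rule sets_measure_of)
    (use generated_subset_Pow[of M] sets.space_closed[of "history k"] space_history in blast)

lemma message_message_history:
  "i \<in> {1..n} \<Longrightarrow> g k i \<in> borel_measurable (message_history k)"
  by (rule measurable_generated[OF _ space_message_history])
    (auto simp: sets_message_history intro!: sigma_sets.Basic)

lemma subalgebra_message_history:
  assumes "k < K"
  shows "subalgebra M (message_history k)"
proof -
  have "generated M borel (g k i) \<subseteq> sets M" if "i \<in> {1..n}" for i
    using g_random[OF assms that] by (intro generated_subset) auto
  moreover have "sets (history k) \<subseteq> sets M"
    using subalgebra_history[of k] assms by (simp add: subalgebra_def)
  ultimately have "sets (message_history k) \<subseteq> sets M"
    unfolding sets_message_history by (intro sets.sigma_sets_subset) blast
  then show ?thesis by (simp add: subalgebra_def space_message_history)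
qed

lemma measurable_history_mono:
  "k \<le> l \<Longrightarrow> X \<in> history k \<rightarrow>\<^sub>M S \<Longrightarrow> X \<in> history l \<rightarrow>\<^sub>M S"
  using history_mono[of k l] by (auto simp: measurable_def space_history)

lemma iterate_history: "k \<le> K \<Longrightarrow> x k \<in> borel_measurable (history k)"
proof (induction k)
  case 0
  have "x 0 \<in> borel_measurable (history 0) \<longleftrightarrow> (\<lambda>_. x0) \<in> borel_measurable (history 0)"
    by (rule measurable_cong) (simp add: x_init space_history)
  then show ?case by simp
next
  case (Suc k)
  have "x k \<in> borel_measurable (history (Suc k))"
    using Suc by (intro measurable_history_mono[of k "Suc k"]) auto
  then have "(\<lambda>\<omega>. x k \<omega> - \<gamma> *\<^sub>R agg k \<omega>) \<in> borel_measurable (history (Suc k))"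
    using agg_history[of k "Suc k"] by (intro borel_measurable_diff borel_measurable_scaleR) auto
  moreover have "x (Suc k) \<in> borel_measurable (history (Suc k)) \<longleftrightarrow>
      (\<lambda>\<omega>. x k \<omega> - \<gamma> *\<^sub>R agg k \<omega>) \<in> borel_measurable (history (Suc k))"
    using Suc.prems by (intro measurable_cong) (simp add: x_step space_history)
  ultimately show ?case by simp
qed

lemma reference_history: "k \<le> K \<Longrightarrow> i \<in> \<G> \<Longrightarrow> w k i \<in> borel_measurable (history k)"
proof (induction k)
  case 0
  have "w 0 i \<in> borel_measurable (history 0) \<longleftrightarrow> (\<lambda>_. x0) \<in> borel_measurable (history 0)"
    using 0 by (intro measurable_cong) (simp add: w_init space_history)
  then show ?case by simp
next
  case (Suc k)
  note [measurable] = coin_history[of k "Suc k" i, OF _ Suc.prems(2)]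
  have [measurable]: "x k \<in> borel_measurable (history (Suc k))" "w k i \<in> borel_measurable (history (Suc k))"
    using Suc iterate_history[of k] by (auto intro: measurable_history_mono[of k "Suc k"])
  have "(\<lambda>\<omega>. if coin k i \<omega> then x k \<omega> else w k i \<omega>) \<in> borel_measurable (history (Suc k))"
    by measurable
  moreover have "w (Suc k) i \<in> borel_measurable (history (Suc k)) \<longleftrightarrow>
      (\<lambda>\<omega>. if coin k i \<omega> then x k \<omega> else w k i \<omega>) \<in> borel_measurable (history (Suc k))"
    using Suc.prems by (intro measurable_cong) (simp add: w_step space_history)
  ultimately show ?case by simp
qed

text \<open>The sampled index lies in \<open>{1..m}\<close> only almost surely, and for other \<open>j\<close> the gradient of \<open>f j\<close> may
  fail to be measurable. Clamping the index changes it on a null set and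
  makes every function of it a finite combination of functions of the history.\<close>

definition sample :: "nat \<Rightarrow> nat \<Rightarrow> nat \<Rightarrow> '\<omega> \<Rightarrow> nat" where
  "sample k i t \<omega> = (if smp k i t \<omega> \<in> {1..m} then smp k i t \<omega> else 1)"

lemma sample_in: "sample k i t \<omega> \<in> {1..m}"
  using components by (simp add: sample_def)

context
  fixes k assumes k: "k < K"
begin

lemma AE_sample_eq_smp:
  assumes "i \<in> \<G>" "t \<in> {1..b}"
  shows "AE \<omega> in M. sample k i t \<omega> = smp k i t \<omega>"
proof -
  have "AE j in distr M (count_space UNIV) (smp k i t). j \<in> {1..m}"
    unfolding conjunct2[OF smp_uniform[OF k assms]] AE_measure_pmf_iff
    using set_pmf_of_set[OF indices_nonempty(2,1)] by blast
  then have "AE \<omega> in M. smp k i t \<omega> \<in> {1..m}"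
    using smp_uniform[OF k assms] by (subst (asm) AE_distr_iff) auto
  then show ?thesis by eventually_elim (simp add: sample_def)
qed

lemma prob_smp:
  assumes "i \<in> \<G>" "t \<in> {1..b}" "j \<in> {1..m}"
  shows "prob {\<omega> \<in> space M. smp k i t \<omega> = j} = 1 / real m"
proof -
  have "prob {\<omega> \<in> space M. smp k i t \<omega> = j} = measure (distr M (count_space UNIV) (smp k i t)) {j}"
    using smp_uniform[OF k assms(1,2)] by (subst measure_distr) (auto intro!: arg_cong[where f = prob])
  then show ?thesis
    using smp_uniform[OF k assms(1,2)] assms(3) indices_nonempty by (simp add: measure_pmf_single)
qed

lemma measurable_sample [measurable]:
  assumes "i \<in> \<G>" "t \<in> {1..b}"
  shows "sample k i t \<in> M \<rightarrow>\<^sub>M count_space {1..m}"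
proof -
  have [measurable]: "random_variable (count_space UNIV) (smp k i t)"
    using smp_uniform[OF k assms] by simp
  have "random_variable (count_space UNIV) (sample k i t)"
    unfolding sample_def[abs_def] 
    by (rule measurable_compose[where f = "smp k i t" and N = "count_space UNIV"
          and g = "\<lambda>j. if j \<in> {1..m} then j else 1"])
      simp_all
  then show ?thesis
    using sample_in by (auto simp: measurable_count_space_eq2 measurable_count_space_eq_countable)
qed

lemma sets_sample_eq:
  assumes "i \<in> \<G>" "t \<in> {1..b}" "j \<in> {1..m}"
  shows "{\<omega> \<in> space M. sample k i t \<omega> = j} \<in> sets M"
proof -
  have "sample k i t -` {j} \<inter> space M \<in> sets M"
    using assms by (intro measurable_sets[OF measurable_sample]) auto
  also have "sample k i t -` {j} \<inter> space M = {\<omega> \<in> space M. sample k i t \<omega> = j}" by auto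
  finally show ?thesis .
qed

text \<open>Clamping changes the samples on a null set, so they inherit joint independence and the
  uniform law. One sample gives means and second moments, two samples give the orthogonality of the noise.\<close>

lemma prob_samples:
  assumes S: "S \<subseteq> \<G> \<times> {1..b}" and C: "C \<in> sets (history k)" and J: "\<And>s. s \<in> S \<Longrightarrow> J s \<in> {1..m}"
  shows "prob ({\<omega> \<in> space M. \<forall>s\<in>S. sample k (fst s) (snd s) \<omega> = J s} \<inter> C)
    = (1 / real m) ^ card S * prob C"
proof -
  (* None stands for the past and Some for a sample, as in the joint independence of the run. *)
  define E where "E r = (case r of None \<Rightarrow> C
    | Some s \<Rightarrow> {\<omega> \<in> space M. smp k (fst s) (snd s) \<omega> = J s})" for r
  let ?I = "insert None (Some ` S)"
  have fin: "finite S" using S regular_nonempty finite_subset by blast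
  have CM: "C \<in> sets M"
    using C subalgebra_history[of k] k by (auto simp: subalgebra_def)
  have smp_meas: "random_variable (count_space UNIV) (smp k (fst s) (snd s))" if "s \<in> S" for s
    using smp_uniform[OF k] that S by fastforce
  have "prob (\<Inter>r\<in>?I. E r) = (\<Prod>r\<in>?I. prob (E r))"
  proof (rule indep_setsD[OF smp_indep[OF k]])
    show "\<forall>r\<in>?I. E r \<in> (case r of None \<Rightarrow> sets (history k)
        | Some (i, t) \<Rightarrow> generated M (count_space UNIV) (smp k i t))"
    proof
      fix r assume "r \<in> ?I"
      then show "E r \<in> (case r of None \<Rightarrow> sets (history k)
        | Some (i, t) \<Rightarrow> generated M (count_space UNIV) (smp k i t))"
      proof
        assume "r \<in> Some ` S"
        then obtain s where r: "r = Some s" by auto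
        have "smp k (fst s) (snd s) -` {J s} \<inter> space M \<in> generated M (count_space UNIV) (smp k (fst s) (snd s))"
          unfolding generated_def by (rule in_vimage_algebra) simp
        moreover have "smp k (fst s) (snd s) -` {J s} \<inter> space M = E r"
          by (auto simp: r E_def)
        ultimately show ?thesis by (simp add: r case_prod_unfold)
      qed (simp add: E_def C)
    qed
  qed (use S fin in auto)
  also have "(\<Prod>r\<in>?I. prob (E r)) = prob C * (\<Prod>s\<in>S. prob (E (Some s)))"
    using fin by (simp add: prod.reindex E_def)
  also have "(\<Prod>s\<in>S. prob (E (Some s))) = (\<Prod>s\<in>S. 1 / real m)"
    unfolding E_def option.case using S J by (intro prod.cong refl prob_smp) auto
  also have "(\<Inter>r\<in>?I. E r) = {\<omega> \<in> space M. \<forall>s\<in>S. smp k (fst s) (snd s) \<omega> = J s} \<inter> C"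
    using sets.sets_into_space[OF CM] by (auto simp: E_def)
  also have "prob \<dots> = prob ({\<omega> \<in> space M. \<forall>s\<in>S. sample k (fst s) (snd s) \<omega> = J s} \<inter> C)"
  proof (rule finite_measure_eq_AE)
    have "AE \<omega> in M. \<forall>s\<in>S. sample k (fst s) (snd s) \<omega> = smp k (fst s) (snd s) \<omega>"
      using S by (intro AE_finite_allI[OF fin] AE_sample_eq_smp) auto
    then show "AE \<omega> in M. (\<omega> \<in> {\<omega> \<in> space M. \<forall>s\<in>S. smp k (fst s) (snd s) \<omega> = J s} \<inter> C) \<longleftrightarrow>
        (\<omega> \<in> {\<omega> \<in> space M. \<forall>s\<in>S. sample k (fst s) (snd s) \<omega> = J s} \<inter> C)"
      by eventually_elim auto
    have "{\<omega> \<in> space M. smp k (fst s) (snd s) \<omega> = J s} \<in> sets M" if "s \<in> S" for s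
      using smp_meas[OF that] by measurable
    then show "{\<omega> \<in> space M. \<forall>s\<in>S. smp k (fst s) (snd s) \<omega> = J s} \<inter> C \<in> sets M"
      using CM fin by (intro sets.Int sets.sets_Collect_finite_All) auto
    have "{\<omega> \<in> space M. sample k (fst s) (snd s) \<omega> = J s} \<in> sets M" if "s \<in> S" for s
      using that S J[OF that] by (intro sets_sample_eq) auto
    then show "{\<omega> \<in> space M. \<forall>s\<in>S. sample k (fst s) (snd s) \<omega> = J s} \<inter> C \<in> sets M"
      using CM fin by (intro sets.Int sets.sets_Collect_finite_All) auto
  qed
  finally show ?thesis by (simp add: mult.commute)
qed

lemma
  fixes F :: "nat \<Rightarrow> '\<omega> \<Rightarrow> real"
  assumes s: "i \<in> \<G>" "t \<in> {1..b}"
    and F: "\<And>j. j \<in> {1..m} \<Longrightarrow> F j \<in> borel_measurable (history k)"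
      "\<And>j. j \<in> {1..m} \<Longrightarrow> integrable M (F j)"
  shows integrable_at_sample: "integrable M (\<lambda>\<omega>. F (sample k i t \<omega>) \<omega>)"
    and integral_at_sample:
      "(\<integral>\<omega>. F (sample k i t \<omega>) \<omega> \<partial>M) = (\<integral>\<omega>. average {1..m} (\<lambda>j. F j \<omega>) \<partial>M)"
proof -
  have indep: "prob ({\<omega> \<in> space M. sample k i t \<omega> = j} \<inter> C) = 1 / real m * prob C"
    if "j \<in> {1..m}" "C \<in> sets (history k)" for j C
    using prob_samples[of "{(i, t)}" C "\<lambda>_. j"] s that by simp
  have J: "sample k i t \<omega> \<in> {1..m}" for \<omega> by (rule sample_in)
  note index = integral_at_uniform_index[OF subalgebra_history[OF less_imp_le[OF k]] finite_atLeastAtMost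
      J sets_sample_eq[OF s] indep F]
  show "integrable M (\<lambda>\<omega>. F (sample k i t \<omega>) \<omega>)" by (rule index(1))
  show "(\<integral>\<omega>. F (sample k i t \<omega>) \<omega> \<partial>M) = (\<integral>\<omega>. average {1..m} (\<lambda>j. F j \<omega>) \<partial>M)"
  proof -
    have "(\<integral>\<omega>. F (sample k i t \<omega>) \<omega> \<partial>M) = 1 / real m * (\<Sum>j\<in>{1..m}. \<integral>\<omega>. F j \<omega> \<partial>M)"
      by (rule index(2))
    also have "\<dots> = average {1..m} (\<lambda>j. \<integral>\<omega>. F j \<omega> \<partial>M)" by (simp add: average_def)
    also have "\<dots> = (\<integral>\<omega>. average {1..m} (\<lambda>j. F j \<omega>) \<partial>M)"
      by (rule integral_average[symmetric]) (rule F(2))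
    finally show ?thesis .
  qed
qed

lemma integral_at_sample_pair:
  fixes F :: "nat \<Rightarrow> nat \<Rightarrow> '\<omega> \<Rightarrow> real"
  assumes s: "i \<in> \<G>" "t \<in> {1..b}" "i' \<in> \<G>" "t' \<in> {1..b}" "(i, t) \<noteq> (i', t')"
    and F: "\<And>j j'. j \<in> {1..m} \<Longrightarrow> j' \<in> {1..m} \<Longrightarrow> F j j' \<in> borel_measurable (history k)"
      "\<And>j j'. j \<in> {1..m} \<Longrightarrow> j' \<in> {1..m} \<Longrightarrow> integrable M (F j j')"
  shows "(\<integral>\<omega>. F (sample k i t \<omega>) (sample k i' t' \<omega>) \<omega> \<partial>M)
    = (\<integral>\<omega>. average {1..m} (\<lambda>j. average {1..m} (\<lambda>j'. F j j' \<omega>)) \<partial>M)"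
proof -
  let ?T = "{1..m} \<times> {1..m}" and ?J = "\<lambda>\<omega>. (sample k i t \<omega>, sample k i' t' \<omega>)"
  have fin: "finite ?T" by simp
  have J: "?J \<omega> \<in> ?T" for \<omega> using sample_in by simp
  have sets: "{\<omega> \<in> space M. ?J \<omega> = jj} \<in> sets M" if "jj \<in> ?T" for jj
  proof -
    have "{\<omega> \<in> space M. ?J \<omega> = jj} = {\<omega> \<in> space M. sample k i t \<omega> = fst jj} \<inter>
        {\<omega> \<in> space M. sample k i' t' \<omega> = snd jj}" by auto
    then show ?thesis using that s by (auto intro!: sets.Int sets_sample_eq)
  qed
  have indep: "prob ({\<omega> \<in> space M. ?J \<omega> = jj} \<inter> C) = (1 / real m) ^ 2 * prob C"
    if "jj \<in> ?T" "C \<in> sets (history k)" for jj C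
  proof -
    have "{\<omega> \<in> space M. ?J \<omega> = jj} = {\<omega> \<in> space M. \<forall>s\<in>{(i, t), (i', t')}.
        sample k (fst s) (snd s) \<omega> = (if s = (i, t) then fst jj else snd jj)}"
      using s(5) by auto
    moreover have "card {(i, t), (i', t')} = 2" using s(5) by simp
    ultimately show ?thesis
      using prob_samples[of "{(i, t), (i', t')}" C "\<lambda>s. if s = (i, t) then fst jj else snd jj"] s that
      by auto
  qed
  have "(\<integral>\<omega>. (\<lambda>(j, j'). F j j') (?J \<omega>) \<omega> \<partial>M) = (1 / real m) ^ 2 * (\<Sum>(j, j')\<in>?T. \<integral>\<omega>. F j j' \<omega> \<partial>M)"
    unfolding case_prod_unfold
    by (rule integral_at_uniform_index(2)[OF subalgebra_history[OF less_imp_le[OF k]] fin J sets indep])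
      (use F in auto)
  also have "\<dots> = average {1..m} (\<lambda>j. average {1..m} (\<lambda>j'. \<integral>\<omega>. F j j' \<omega> \<partial>M))"
    unfolding sum.cartesian_product[symmetric]
    by (simp add: average_def power2_eq_square sum_distrib_left)
  also have "\<dots> = average {1..m} (\<lambda>j. \<integral>\<omega>. average {1..m} (\<lambda>j'. F j j' \<omega>) \<partial>M)"
    by (intro average_cong integral_average[symmetric] F)
  also have "\<dots> = (\<integral>\<omega>. average {1..m} (\<lambda>j. average {1..m} (\<lambda>j'. F j j' \<omega>)) \<partial>M)"
    by (intro integral_average[symmetric] integrable_average F)
  finally show ?thesis by simp
qed

end

section \<open>Messages of the regular workers\<close>

lemma square_integrable_gradient:
  assumes j: "j \<in> {1..m}" and X: "square_integrable M X"
  shows "square_integrable M (\<lambda>\<omega>. gradient (f j) (X \<omega>))"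
proof -
  have [measurable]: "X \<in> borel_measurable M" using X by (simp add: square_integrable_def)
  have grad: "(\<lambda>\<omega>. gradient (f j) (X \<omega>)) \<in> borel_measurable M"
    by (rule measurable_compose[OF _ borel_measurable_gradient[OF j]]) measurable
  have "square_integrable M (\<lambda>\<omega>. gradient (f j) (X \<omega>) - gradient (f j) xs)"
    by (rule square_integrable_dominated[OF square_integrable_diff[OF X square_integrable_const[of xs]]])
      (use grad norm_gradient_diff_le[OF j] in auto)
  from square_integrable_add[OF this square_integrable_const[of "gradient (f j) xs"]]
  show ?thesis by simp
qed

lemma square_integrable_full_gradient:
  "square_integrable M X \<Longrightarrow> square_integrable M (\<lambda>\<omega>. full_gradient (X \<omega>))"
  unfolding full_gradient_eq_average by (intro square_integrable_average square_integrable_gradient)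

lemma square_integrable_svrg_estimate:
  assumes "j \<in> {1..m}" "square_integrable M X" "square_integrable M R"
  shows "square_integrable M (\<lambda>\<omega>. svrg_estimate (X \<omega>) (R \<omega>) j)"
  unfolding svrg_estimate_def using assms
  by (intro square_integrable_add square_integrable_diff square_integrable_gradient
      square_integrable_full_gradient)

lemma integrable_gradient_gap:
  assumes "square_integrable M X"
  shows "integrable M (\<lambda>\<omega>. gradient_gap (X \<omega>))"
  unfolding gradient_gap_def
proof (rule integrable_average)
  fix j assume "j \<in> {1..m}"
  then have "square_integrable M (\<lambda>\<omega>. gradient (f j) (X \<omega>) - gradient (f j) xs)"
    using assms by (intro square_integrable_diff square_integrable_gradient square_integrable_const)
  then show "integrable M (\<lambda>\<omega>. (norm (gradient (f j) (X \<omega>) - gradient (f j) xs))\<^sup>2)"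
    by (simp add: square_integrable_def)
qed

text \<open>The robustness guarantee \<open>c * \<delta> * \<rho>\<^sup>2\<close> for \<open>\<rho>\<^sup>2 = 8 * \<sigma>\<^sup>2 / real b\<close>, the bound on the mean square
  distance of two regular messages.\<close>

definition aggregation_error :: real where
  "aggregation_error = c * \<delta> * (8 * \<sigma>\<^sup>2 / real b)"

lemma aggregation_error_nonneg: "0 \<le> aggregation_error"
  using c_pos delta_nonneg by (simp add: aggregation_error_def)

definition sampled_estimate :: "nat \<Rightarrow> nat \<Rightarrow> nat \<Rightarrow> '\<omega> \<Rightarrow> 'v" where
  "sampled_estimate k i t \<omega> = svrg_estimate (x k \<omega>) (w k i \<omega>) (sample k i t \<omega>)"

definition noise :: "nat \<Rightarrow> nat \<Rightarrow> nat \<Rightarrow> '\<omega> \<Rightarrow> 'v" where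
  "noise k i t \<omega> = sampled_estimate k i t \<omega> - full_gradient (x k \<omega>)"

context
  fixes k
  assumes k: "k < K"
    and x_sq: "square_integrable M (x k)"
    and w_sq: "\<And>i. i \<in> \<G> \<Longrightarrow> square_integrable M (w k i)"
begin

text \<open>Messages and averages of clamped estimates agree only almost surely, since the worker evaluates
  the gradient of whatever component was drawn.\<close>

lemma AE_message_eq:
  assumes i: "i \<in> \<G>"
  shows "AE \<omega> in M. g k i \<omega> = average {1..b} (\<lambda>t. sampled_estimate k i t \<omega>)"
proof -
  have "AE \<omega> in M. \<forall>t\<in>{1..b}. sample k i t \<omega> = smp k i t \<omega>"
    by (intro AE_finite_allI AE_sample_eq_smp k i) auto
  then show ?thesis
  proof (rule AE_mp, intro AE_I2 impI)
    fix \<omega> assume "\<omega> \<in> space M" and eq: "\<forall>t\<in>{1..b}. sample k i t \<omega> = smp k i t \<omega>"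
    then have "g k i \<omega> = average {1..b} (\<lambda>t. gradient (f (smp k i t \<omega>)) (x k \<omega>)
        - gradient (f (smp k i t \<omega>)) (w k i \<omega>)) + full_gradient (w k i \<omega>)"
      by (simp add: g_regular[OF k i] average_def)
    also have "\<dots> = average {1..b} (\<lambda>t. svrg_estimate (x k \<omega>) (w k i \<omega>) (smp k i t \<omega>))"
      unfolding svrg_estimate_def by (rule average_add_const[OF batch_nonempty, symmetric])
    also have "\<dots> = average {1..b} (\<lambda>t. sampled_estimate k i t \<omega>)"
      by (rule average_cong) (simp add: sampled_estimate_def eq)
    finally show "g k i \<omega> = average {1..b} (\<lambda>t. sampled_estimate k i t \<omega>)" .
  qed
qed

lemma svrg_estimate_history:
  assumes "i \<in> \<G>" "j \<in> {1..m}"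
  shows "(\<lambda>\<omega>. svrg_estimate (x k \<omega>) (w k i \<omega>) j) \<in> borel_measurable (history k)"
  unfolding svrg_estimate_def using k assms
  by (intro borel_measurable_add borel_measurable_diff
      measurable_compose[OF iterate_history borel_measurable_gradient]
      measurable_compose[OF reference_history borel_measurable_gradient]
      measurable_compose[OF reference_history borel_measurable_full_gradient]) auto

lemma full_gradient_history: "(\<lambda>\<omega>. full_gradient (x k \<omega>)) \<in> borel_measurable (history k)"
  using k by (intro measurable_compose[OF iterate_history borel_measurable_full_gradient]) auto

lemma square_integrable_sampled_estimate:
  assumes s: "i \<in> \<G>" "t \<in> {1..b}"
  shows "square_integrable M (sampled_estimate k i t)"
proof -
  have sq: "square_integrable M (\<lambda>\<omega>. svrg_estimate (x k \<omega>) (w k i \<omega>) j)" if "j \<in> {1..m}" for j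
    using that by (intro square_integrable_svrg_estimate x_sq w_sq s)
  have "sampled_estimate k i t \<in> borel_measurable M"
    unfolding sampled_estimate_def[abs_def]
    by (rule measurable_compose_countable'[OF _ measurable_sample[OF k s]])
      (use sq in \<open>auto simp: square_integrable_def\<close>)
  moreover have "integrable M (\<lambda>\<omega>. (norm (sampled_estimate k i t \<omega>))\<^sup>2)"
    unfolding sampled_estimate_def
    by (rule integrable_at_sample[OF k s, where F = "\<lambda>j \<omega>. (norm (svrg_estimate (x k \<omega>) (w k i \<omega>) j))\<^sup>2"])
      (use sq svrg_estimate_history[OF s(1)] in \<open>auto simp: square_integrable_def\<close>)
  ultimately show ?thesis by (simp add: square_integrable_def)
qed

lemma square_integrable_noise:
  "i \<in> \<G> \<Longrightarrow> t \<in> {1..b} \<Longrightarrow> square_integrable M (noise k i t)"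
  unfolding noise_def[abs_def]
  by (intro square_integrable_diff square_integrable_sampled_estimate square_integrable_full_gradient x_sq)

lemma square_integrable_message:
  assumes "i \<in> \<G>"
  shows "square_integrable M (g k i)"
proof (rule square_integrable_cong_AE[OF _ _ AE_message_eq[OF assms]])
  show "square_integrable M (\<lambda>\<omega>. average {1..b} (\<lambda>t. sampled_estimate k i t \<omega>))"
    by (intro square_integrable_average square_integrable_sampled_estimate assms)
  show "g k i \<in> borel_measurable M"
    using g_random[OF k] assms regular_subset by auto
qed

text \<open>Given the past, each estimate in the batch has the full gradient as its mean, because the control
  variate does not change the average over the components.\<close>

lemma integral_message_inner_history:
  assumes i: "i \<in> \<G>" and Y: "Y \<in> borel_measurable (history k)" "square_integrable M Y"
  shows "(\<integral>\<omega>. g k i \<omega> \<bullet> Y \<omega> \<partial>M) = (\<integral>\<omega>. full_gradient (x k \<omega>) \<bullet> Y \<omega> \<partial>M)"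
proof -
  have sq: "square_integrable M (\<lambda>\<omega>. svrg_estimate (x k \<omega>) (w k i \<omega>) j)" if "j \<in> {1..m}" for j
    using that by (intro square_integrable_svrg_estimate x_sq w_sq i)
  have one: "(\<integral>\<omega>. sampled_estimate k i t \<omega> \<bullet> Y \<omega> \<partial>M) = (\<integral>\<omega>. full_gradient (x k \<omega>) \<bullet> Y \<omega> \<partial>M)"
    if t: "t \<in> {1..b}" for t
  proof -
    have "(\<integral>\<omega>. sampled_estimate k i t \<omega> \<bullet> Y \<omega> \<partial>M)
        = (\<integral>\<omega>. average {1..m} (\<lambda>j. svrg_estimate (x k \<omega>) (w k i \<omega>) j \<bullet> Y \<omega>) \<partial>M)"
      unfolding sampled_estimate_def
      by (rule integral_at_sample[OF k i t, where F = "\<lambda>j \<omega>. svrg_estimate (x k \<omega>) (w k i \<omega>) j \<bullet> Y \<omega>"])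
        (use sq svrg_estimate_history[OF i] Y in \<open>auto intro!: square_integrable_inner borel_measurable_inner\<close>)
    then show ?thesis by (simp add: average_svrg_estimate flip: average_inner_left)
  qed
  have "(\<integral>\<omega>. g k i \<omega> \<bullet> Y \<omega> \<partial>M) = (\<integral>\<omega>. average {1..b} (\<lambda>t. sampled_estimate k i t \<omega>) \<bullet> Y \<omega> \<partial>M)"
  proof (rule integral_cong_AE)
    show "AE \<omega> in M. g k i \<omega> \<bullet> Y \<omega> = average {1..b} (\<lambda>t. sampled_estimate k i t \<omega>) \<bullet> Y \<omega>"
      using AE_message_eq[OF i] by eventually_elim simp
    show "(\<lambda>\<omega>. g k i \<omega> \<bullet> Y \<omega>) \<in> borel_measurable M"
      by (intro borel_measurable_integrable square_integrable_inner square_integrable_message i Y)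
    show "(\<lambda>\<omega>. average {1..b} (\<lambda>t. sampled_estimate k i t \<omega>) \<bullet> Y \<omega>) \<in> borel_measurable M"
      by (intro borel_measurable_integrable square_integrable_inner square_integrable_average
          square_integrable_sampled_estimate i Y)
  qed
  also have "\<dots> = average {1..b} (\<lambda>t. \<integral>\<omega>. sampled_estimate k i t \<omega> \<bullet> Y \<omega> \<partial>M)"
    unfolding average_inner_left
    by (intro integral_average square_integrable_inner square_integrable_sampled_estimate i Y)
  also have "\<dots> = average {1..b} (\<lambda>t. \<integral>\<omega>. full_gradient (x k \<omega>) \<bullet> Y \<omega> \<partial>M)"
    by (intro average_cong one)
  finally show ?thesis by (simp only: average_const[OF batch_nonempty])
qed

text \<open>Jensen's inequality reduces the batch to a single estimate, so that the batch size does not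
  enter.\<close>

lemma integral_norm_message_sq_le:
  assumes i: "i \<in> \<G>"
  shows "(\<integral>\<omega>. (norm (g k i \<omega>))\<^sup>2 \<partial>M)
    \<le> 2 * (\<integral>\<omega>. gradient_gap (x k \<omega>) \<partial>M) + 2 * (\<integral>\<omega>. gradient_gap (w k i \<omega>) \<partial>M)"
proof -
  let ?bound = "\<integral>\<omega>. 2 * gradient_gap (x k \<omega>) + 2 * gradient_gap (w k i \<omega>) \<partial>M"
  have sq: "square_integrable M (\<lambda>\<omega>. svrg_estimate (x k \<omega>) (w k i \<omega>) j)" if "j \<in> {1..m}" for j
    using that by (intro square_integrable_svrg_estimate x_sq w_sq i)
  have gaps: "integrable M (\<lambda>\<omega>. gradient_gap (x k \<omega>))" "integrable M (\<lambda>\<omega>. gradient_gap (w k i \<omega>))"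
    by (intro integrable_gradient_gap x_sq w_sq i)+
  have one: "(\<integral>\<omega>. (norm (sampled_estimate k i t \<omega>))\<^sup>2 \<partial>M) \<le> ?bound" if t: "t \<in> {1..b}" for t
  proof -
    have "(\<integral>\<omega>. (norm (sampled_estimate k i t \<omega>))\<^sup>2 \<partial>M)
        = (\<integral>\<omega>. average {1..m} (\<lambda>j. (norm (svrg_estimate (x k \<omega>) (w k i \<omega>) j))\<^sup>2) \<partial>M)"
      unfolding sampled_estimate_def
      by (rule integral_at_sample[OF k i t, where F = "\<lambda>j \<omega>. (norm (svrg_estimate (x k \<omega>) (w k i \<omega>) j))\<^sup>2"])
        (use sq svrg_estimate_history[OF i] in \<open>auto simp: square_integrable_def\<close>)
    also have "\<dots> \<le> ?bound"
      by (intro integral_mono integrable_average svrg_estimate_second_moment_le)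
        (use sq gaps in \<open>auto simp: square_integrable_def\<close>)
    finally show ?thesis .
  qed
  have samples: "integrable M (\<lambda>\<omega>. (norm (sampled_estimate k i t \<omega>))\<^sup>2)" if "t \<in> {1..b}" for t
    using square_integrable_sampled_estimate[OF i that] by (simp add: square_integrable_def)
  have "(\<integral>\<omega>. (norm (g k i \<omega>))\<^sup>2 \<partial>M) \<le> (\<integral>\<omega>. average {1..b} (\<lambda>t. (norm (sampled_estimate k i t \<omega>))\<^sup>2) \<partial>M)"
  proof (rule integral_mono_AE)
    show "AE \<omega> in M. (norm (g k i \<omega>))\<^sup>2 \<le> average {1..b} (\<lambda>t. (norm (sampled_estimate k i t \<omega>))\<^sup>2)"
      using AE_message_eq[OF i] by eventually_elim (simp add: norm_average_sq_le[OF batch_nonempty])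
    show "integrable M (\<lambda>\<omega>. (norm (g k i \<omega>))\<^sup>2)"
      using square_integrable_message[OF i] by (simp add: square_integrable_def)
    show "integrable M (\<lambda>\<omega>. average {1..b} (\<lambda>t. (norm (sampled_estimate k i t \<omega>))\<^sup>2))"
      by (intro integrable_average samples)
  qed
  also have "\<dots> = average {1..b} (\<lambda>t. \<integral>\<omega>. (norm (sampled_estimate k i t \<omega>))\<^sup>2 \<partial>M)"
    by (intro integral_average samples)
  also have "\<dots> \<le> average {1..b} (\<lambda>t. ?bound)"
    by (intro average_mono one)
  also have "\<dots> = 2 * (\<integral>\<omega>. gradient_gap (x k \<omega>) \<partial>M) + 2 * (\<integral>\<omega>. gradient_gap (w k i \<omega>) \<partial>M)"
    using gaps by (simp add: average_const[OF batch_nonempty])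
  finally show ?thesis .
qed

text \<open>Given the past the two indices are independent and uniform, and the deviations of the estimates
  of each worker average to \<open>0\<close> over the index. Different positions of one batch and different workers
  are covered alike.\<close>

lemma integral_noise_inner_eq_0:
  assumes s: "i \<in> \<G>" "t \<in> {1..b}" "i' \<in> \<G>" "t' \<in> {1..b}" "(i, t) \<noteq> (i', t')"
  shows "(\<integral>\<omega>. noise k i t \<omega> \<bullet> noise k i' t' \<omega> \<partial>M) = 0"
proof -
  define D where "D i j \<omega> = svrg_estimate (x k \<omega>) (w k i \<omega>) j - full_gradient (x k \<omega>)" for i j \<omega>
  have D_sq: "square_integrable M (D i j)" if "i \<in> \<G>" "j \<in> {1..m}" for i j
    unfolding D_def[abs_def] using that
    by (intro square_integrable_diff square_integrable_svrg_estimate square_integrable_full_gradient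
        x_sq w_sq)
  have D_history: "D i j \<in> borel_measurable (history k)" if "i \<in> \<G>" "j \<in> {1..m}" for i j
    unfolding D_def[abs_def] using that
    by (intro borel_measurable_diff svrg_estimate_history full_gradient_history)
  have D_average: "average {1..m} (\<lambda>j. D i j \<omega>) = 0" for i \<omega>
    unfolding D_def average_diff_const[OF indices_nonempty] by (simp add: average_svrg_estimate)
  have "(\<integral>\<omega>. noise k i t \<omega> \<bullet> noise k i' t' \<omega> \<partial>M)
      = (\<integral>\<omega>. D i (sample k i t \<omega>) \<omega> \<bullet> D i' (sample k i' t' \<omega>) \<omega> \<partial>M)"
    by (simp add: noise_def sampled_estimate_def D_def)
  also have "\<dots> = (\<integral>\<omega>. average {1..m} (\<lambda>j. average {1..m} (\<lambda>j'. D i j \<omega> \<bullet> D i' j' \<omega>)) \<partial>M)"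
    by (rule integral_at_sample_pair[OF k s, where F = "\<lambda>j j' \<omega>. D i j \<omega> \<bullet> D i' j' \<omega>"])
      (use s in \<open>auto intro!: square_integrable_inner D_sq borel_measurable_inner D_history\<close>)
  also have "\<dots> = 0"
  proof -
    have "average {1..m} (\<lambda>j'. D i j \<omega> \<bullet> D i' j' \<omega>) = 0" for j \<omega>
      using D_average[of i' \<omega>] average_inner_left[of "{1..m}" "\<lambda>j'. D i' j' \<omega>" "D i j \<omega>"]
      by (simp add: inner_commute)
    then show ?thesis by (simp add: average_const[OF indices_nonempty])
  qed
  finally show ?thesis .
qed

lemma integral_norm_noise_sq_le:
  assumes s: "i \<in> \<G>" "t \<in> {1..b}"
  shows "(\<integral>\<omega>. (norm (noise k i t \<omega>))\<^sup>2 \<partial>M) \<le> 4 * \<sigma>\<^sup>2"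
proof -
  let ?F = "\<lambda>j \<omega>. (norm (svrg_estimate (x k \<omega>) (w k i \<omega>) j - full_gradient (x k \<omega>)))\<^sup>2"
  have F: "?F j \<in> borel_measurable (history k)" "integrable M (?F j)" if "j \<in> {1..m}" for j
  proof -
    have "square_integrable M (\<lambda>\<omega>. svrg_estimate (x k \<omega>) (w k i \<omega>) j - full_gradient (x k \<omega>))"
      using that s by (intro square_integrable_diff square_integrable_svrg_estimate
          square_integrable_full_gradient x_sq w_sq)
    then show "integrable M (?F j)" by (simp add: square_integrable_def)
    show "?F j \<in> borel_measurable (history k)"
      using svrg_estimate_history[OF s(1) that] full_gradient_history by measurable
  qed
  have "(\<integral>\<omega>. (norm (noise k i t \<omega>))\<^sup>2 \<partial>M) = (\<integral>\<omega>. average {1..m} (\<lambda>j. ?F j \<omega>) \<partial>M)"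
    unfolding noise_def sampled_estimate_def
    by (rule integral_at_sample[OF k s, where F = ?F]) (use F in auto)
  also have "\<dots> \<le> (\<integral>\<omega>. 4 * \<sigma>\<^sup>2 \<partial>M)"
    by (intro integral_mono integrable_average svrg_estimate_variance_le F) auto
  finally show ?thesis by (simp add: prob_space)
qed

text \<open>The difference is a signed sum of the \<open>2 * b\<close> orthogonal noises of the two batches, each with
  weight \<open>1 / b\<close> and second moment at most \<open>4 * \<sigma>\<^sup>2\<close>; the common mean cancels.\<close>

lemma integral_norm_message_diff_sq_le:
  assumes il: "i \<in> \<G>" "l \<in> \<G>" "i \<noteq> l"
  shows "(\<integral>\<omega>. (norm (g k i \<omega> - g k l \<omega>))\<^sup>2 \<partial>M) \<le> 8 * \<sigma>\<^sup>2 / real b"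
proof -
  define X where "X s \<omega> = (if fst s = i then 1 / real b else - 1 / real b) *\<^sub>R noise k (fst s) (snd s) \<omega>"
    for s \<omega>
  let ?S = "{i, l} \<times> {1..b}"
  have S: "fst s \<in> \<G>" "snd s \<in> {1..b}" if "s \<in> ?S" for s using that il by auto
  have "AE \<omega> in M. g k i \<omega> - g k l \<omega> = (\<Sum>s\<in>?S. X s \<omega>)"
    using AE_message_eq[OF il(1)] AE_message_eq[OF il(2)]
  proof eventually_elim
    case (elim \<omega>)
    have "(\<Sum>s\<in>?S. X s \<omega>) = (\<Sum>a\<in>{i, l}. \<Sum>t\<in>{1..b}. X (a, t) \<omega>)"
      by (simp add: sum.cartesian_product)
    also have "\<dots> = average {1..b} (\<lambda>t. noise k i t \<omega>) - average {1..b} (\<lambda>t. noise k l t \<omega>)"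
      using il(3) by (simp add: X_def average_def scaleR_sum_right sum_negf)
    also have "\<dots> = g k i \<omega> - g k l \<omega>"
      unfolding noise_def average_diff_const[OF batch_nonempty] by (simp add: elim)
    finally show ?case by simp
  qed
  then have "(\<integral>\<omega>. (norm (g k i \<omega> - g k l \<omega>))\<^sup>2 \<partial>M) = (\<integral>\<omega>. (norm (\<Sum>s\<in>?S. X s \<omega>))\<^sup>2 \<partial>M)"
  proof (intro integral_cong_AE)
    show "AE \<omega> in M. (norm (g k i \<omega> - g k l \<omega>))\<^sup>2 = (norm (\<Sum>s\<in>?S. X s \<omega>))\<^sup>2"
      if "AE \<omega> in M. g k i \<omega> - g k l \<omega> = (\<Sum>s\<in>?S. X s \<omega>)"
      using that by eventually_elim simp
    have "square_integrable M (\<lambda>\<omega>. g k i \<omega> - g k l \<omega>)"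
      by (intro square_integrable_diff square_integrable_message il)
    then show "(\<lambda>\<omega>. (norm (g k i \<omega> - g k l \<omega>))\<^sup>2) \<in> borel_measurable M"
      unfolding square_integrable_def by (intro borel_measurable_integrable) blast
    have "square_integrable M (\<lambda>\<omega>. \<Sum>s\<in>?S. X s \<omega>)"
      unfolding X_def using S by (intro square_integrable_sum square_integrable_scaleR square_integrable_noise)
    then show "(\<lambda>\<omega>. (norm (\<Sum>s\<in>?S. X s \<omega>))\<^sup>2) \<in> borel_measurable M"
      unfolding square_integrable_def by (intro borel_measurable_integrable) blast
  qed
  also have "\<dots> = (\<Sum>s\<in>?S. \<integral>\<omega>. (norm (X s \<omega>))\<^sup>2 \<partial>M)"
  proof (rule integral_norm_sq_sum_orthogonal)
    show "square_integrable M (X s)" if "s \<in> ?S" for s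
      unfolding X_def[abs_def] using S[OF that] by (intro square_integrable_scaleR square_integrable_noise)
    show "(\<integral>\<omega>. X s \<omega> \<bullet> X r \<omega> \<partial>M) = 0" if "s \<in> ?S" "r \<in> ?S" "s \<noteq> r" for s r
    proof -
      have "(\<integral>\<omega>. noise k (fst s) (snd s) \<omega> \<bullet> noise k (fst r) (snd r) \<omega> \<partial>M) = 0"
        using S that by (intro integral_noise_inner_eq_0) auto
      then show ?thesis by (simp add: X_def)
    qed
  qed simp
  also have "\<dots> \<le> (\<Sum>s\<in>?S. 4 * \<sigma>\<^sup>2 / (real b)\<^sup>2)"
  proof (rule sum_mono)
    fix s assume s: "s \<in> ?S"
    have "(\<integral>\<omega>. (norm (X s \<omega>))\<^sup>2 \<partial>M) = (\<integral>\<omega>. (norm (noise k (fst s) (snd s) \<omega>))\<^sup>2 \<partial>M) / (real b)\<^sup>2"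
      by (simp add: X_def power_mult_distrib power_divide)
    also have "\<dots> \<le> 4 * \<sigma>\<^sup>2 / (real b)\<^sup>2"
      using S[OF s] by (intro divide_right_mono integral_norm_noise_sq_le) auto
    finally show "(\<integral>\<omega>. (norm (X s \<omega>))\<^sup>2 \<partial>M) \<le> 4 * \<sigma>\<^sup>2 / (real b)\<^sup>2" .
  qed
  also have "\<dots> = 8 * \<sigma>\<^sup>2 / real b"
    using il(3) batch by (simp add: card_cartesian_product power2_eq_square)
  finally show ?thesis .
qed

section \<open>The aggregation error\<close>

text \<open>Nothing is known yet about the integrability of the aggregated vector, since Byzantine messages
  may have no moments. Stated for the nonnegative integral, the bound itself provides it.\<close>

lemma nn_integral_aggregation_error_le:
  "(\<integral>\<^sup>+\<omega>. ennreal ((norm (agg k \<omega> - average \<G> (\<lambda>i. g k i \<omega>)))\<^sup>2) \<partial>M) \<le> ennreal aggregation_error"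
proof -
  let ?\<rho> = "sqrt (8 * \<sigma>\<^sup>2 / real b)" and ?G = "real (card \<G>)"
  let ?N = "\<Pi>\<^sub>M i\<in>{1..n}. (borel :: 'v measure)"
  have rho: "?\<rho>\<^sup>2 = 8 * \<sigma>\<^sup>2 / real b" "0 \<le> ?\<rho>" by simp_all
  have pair: "(\<integral>\<^sup>+\<omega>. ennreal ((norm (g k i \<omega> - g k l \<omega>))\<^sup>2) \<partial>M)
      \<le> ennreal (if i = l then 0 else ?\<rho>\<^sup>2)" if "i \<in> \<G>" "l \<in> \<G>" for i l
  proof (cases "i = l")
    case False
    have "square_integrable M (\<lambda>\<omega>. g k i \<omega> - g k l \<omega>)"
      by (intro square_integrable_diff square_integrable_message that)
    then show ?thesis
      using integral_norm_message_diff_sq_le[OF that False] False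
      by (subst nn_integral_eq_integral) (auto simp: square_integrable_def rho intro!: ennreal_leI)
  qed simp
  have "ennreal (1 / (?G * (?G - 1))) *
      (\<Sum>i\<in>\<G>. \<Sum>l\<in>\<G>. \<integral>\<^sup>+\<omega>. ennreal ((norm (g k i \<omega> - g k l \<omega>))\<^sup>2) \<partial>M)
      \<le> ennreal (1 / (?G * (?G - 1))) * (\<Sum>i\<in>\<G>. \<Sum>l\<in>\<G>. ennreal (if i = l then 0 else ?\<rho>\<^sup>2))"
    by (intro mult_left_mono sum_mono pair) auto
  also have "\<dots> = ennreal (1 / (?G * (?G - 1)) * (\<Sum>i\<in>\<G>. \<Sum>l\<in>\<G>. if i = l then 0 else ?\<rho>\<^sup>2))"
    using regular(2) by (subst ennreal_mult) (auto simp: sum_ennreal sum_nonneg)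
  also have "(\<Sum>i\<in>\<G>. \<Sum>l\<in>\<G>. if i = l then 0 else ?\<rho>\<^sup>2) = ?G * (?G - 1) * ?\<rho>\<^sup>2"
  proof -
    have "(\<Sum>l\<in>\<G>. if i = l then 0 else ?\<rho>\<^sup>2) = (?G - 1) * ?\<rho>\<^sup>2" if "i \<in> \<G>" for i
    proof -
      have "(\<Sum>l\<in>\<G>. if i = l then 0 else ?\<rho>\<^sup>2) = (\<Sum>l\<in>\<G>. ?\<rho>\<^sup>2 - (if i = l then ?\<rho>\<^sup>2 else 0))"
        by (intro sum.cong) auto
      then show ?thesis
        using that regular_nonempty by (simp add: sum_subtractf left_diff_distrib diff_divide_distrib)
    qed
    then show ?thesis by simp
  qed
  finally have "ennreal (1 / (?G * (?G - 1))) *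
      (\<Sum>i\<in>\<G>. \<Sum>l\<in>\<G>. \<integral>\<^sup>+\<omega>. ennreal ((norm (g k i \<omega> - g k l \<omega>))\<^sup>2) \<partial>M) \<le> ennreal (?\<rho>\<^sup>2)"
    using regular(2) by simp
  then have robust: "(\<integral>\<^sup>+\<omega>. (\<integral>\<^sup>+y. ennreal ((norm (y - average \<G> (\<lambda>i. g k i \<omega>)))\<^sup>2)
      \<partial>A (\<lambda>i\<in>{1..n}. g k i \<omega>)) \<partial>M) \<le> ennreal (c * \<delta> * ?\<rho>\<^sup>2)"
    using g_random[OF k] rho(2)
    by (intro agnostic_robust_aggregator_random_vectors[OF aggregator prob_space_axioms _ regular_subset regular])
  have avg: "average \<G> (\<lambda>i\<in>{1..n}. g k i \<omega>) = average \<G> (\<lambda>i. g k i \<omega>)" for \<omega>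
    using regular_subset by (intro average_cong) auto
  have avg_meas: "average \<G> \<in> borel_measurable ?N"
    unfolding average_def using regular_subset
    by (intro borel_measurable_scaleR borel_measurable_sum measurable_component_singleton) auto
  have "(\<integral>\<^sup>+\<omega>. ennreal ((norm (agg k \<omega> - average \<G> (\<lambda>i\<in>{1..n}. g k i \<omega>)))\<^sup>2) \<partial>M)
      = (\<integral>\<^sup>+\<omega>. \<integral>\<^sup>+y. ennreal ((norm (y - average \<G> (\<lambda>i\<in>{1..n}. g k i \<omega>)))\<^sup>2) \<partial>A (\<lambda>i\<in>{1..n}. g k i \<omega>) \<partial>M)"
  proof (rule nn_integral_cond_law[OF subalgebra_message_history[OF k],
        where S = ?N and h = "\<lambda>v y. ennreal ((norm (y - average \<G> v))\<^sup>2)"])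
    show "(\<lambda>\<omega>. \<lambda>i\<in>{1..n}. g k i \<omega>) \<in> message_history k \<rightarrow>\<^sub>M ?N"
      by (intro measurable_restrict message_message_history)
    show "random_variable borel (agg k)" by (rule agg_random[OF k])
    show "A \<in> ?N \<rightarrow>\<^sub>M prob_algebra borel"
      using aggregator by (simp add: agnostic_robust_aggregator_def aggregation_rule_def)
    show "AE \<omega> in M. real_cond_exp M (message_history k)
        (indicator {\<omega> \<in> space M. agg k \<omega> \<in> D}) \<omega> = measure (A (\<lambda>i\<in>{1..n}. g k i \<omega>)) D"
      if "D \<in> sets borel" for D by (rule agg_law[OF k that])
    note [measurable] = measurable_compose[OF measurable_fst avg_meas]
    show "(\<lambda>(v, y). ennreal ((norm (y - average \<G> v))\<^sup>2)) \<in> borel_measurable (?N \<Otimes>\<^sub>M borel)"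
      by measurable
  qed
  with robust show ?thesis by (simp add: avg rho aggregation_error_def)
qed

lemma
  shows square_integrable_aggregation_error:
      "square_integrable M (\<lambda>\<omega>. agg k \<omega> - average \<G> (\<lambda>i. g k i \<omega>))"
    and integral_aggregation_error_le:
      "(\<integral>\<omega>. (norm (agg k \<omega> - average \<G> (\<lambda>i. g k i \<omega>)))\<^sup>2 \<partial>M) \<le> aggregation_error"
proof -
  let ?e = "\<lambda>\<omega>. agg k \<omega> - average \<G> (\<lambda>i. g k i \<omega>)"
  have "square_integrable M (\<lambda>\<omega>. average \<G> (\<lambda>i. g k i \<omega>))"
    by (intro square_integrable_average square_integrable_message)
  then have [measurable]: "?e \<in> borel_measurable M"
    using agg_random[OF k] by (intro borel_measurable_diff) (auto simp: square_integrable_def)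
  have "(\<integral>\<^sup>+\<omega>. ennreal ((norm (?e \<omega>))\<^sup>2) \<partial>M) < \<infinity>"
    using nn_integral_aggregation_error_le by (rule le_less_trans) simp
  then have int: "integrable M (\<lambda>\<omega>. (norm (?e \<omega>))\<^sup>2)"
    by (intro integrableI_nonneg) auto
  then show "square_integrable M ?e" by (simp add: square_integrable_def)
  show "(\<integral>\<omega>. (norm (?e \<omega>))\<^sup>2 \<partial>M) \<le> aggregation_error"
    using nn_integral_aggregation_error_le nn_integral_eq_integral[OF int] aggregation_error_nonneg
    by simp
qed

end

section \<open>One iteration\<close>

lemma reference_error_eq: "reference_error \<G> m f xs r = average \<G> (\<lambda>i. gradient_gap (r i))"
  by (simp add: reference_error_def gradient_gap_def average_def sum_divide_distrib mult.commute)

context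
  fixes k
  assumes k: "k < K"
    and x_sq: "square_integrable M (x k)"
    and w_sq: "\<And>i. i \<in> \<G> \<Longrightarrow> square_integrable M (w k i)"
begin

lemmas message_sq = square_integrable_message[OF k x_sq w_sq]
  and error_sq = square_integrable_aggregation_error[OF k x_sq w_sq]

lemma square_integrable_iterate_Suc: "square_integrable M (x (Suc k))"
proof -
  have "square_integrable M (\<lambda>\<omega>. x k \<omega> - \<gamma> *\<^sub>R
      ((agg k \<omega> - average \<G> (\<lambda>i. g k i \<omega>)) + average \<G> (\<lambda>i. g k i \<omega>)))"
    by (intro square_integrable_diff square_integrable_scaleR square_integrable_add
        square_integrable_average x_sq error_sq message_sq)
  then have sq: "square_integrable M (\<lambda>\<omega>. x k \<omega> - \<gamma> *\<^sub>R agg k \<omega>)" by simp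
  have "x (Suc k) \<in> borel_measurable M \<longleftrightarrow> (\<lambda>\<omega>. x k \<omega> - \<gamma> *\<^sub>R agg k \<omega>) \<in> borel_measurable M"
    by (rule measurable_cong) (rule x_step[OF k])
  then show ?thesis
    using sq x_step[OF k] by (intro square_integrable_cong_AE[OF sq]) (auto simp: square_integrable_def)
qed

lemma square_integrable_reference_Suc:
  assumes i: "i \<in> \<G>"
  shows "square_integrable M (w (Suc k) i)"
proof -
  have meas: "w (Suc k) i \<in> borel_measurable M"
    using reference_history[of "Suc k" i] subalgebra_history[of "Suc k"] k i
    by (auto intro: measurable_from_subalg)
  have [measurable]: "x k \<in> borel_measurable M" "w k i \<in> borel_measurable M"
    using x_sq w_sq[OF i] by (auto simp: square_integrable_def)
  have "integrable M (\<lambda>\<omega>. (norm (x k \<omega>))\<^sup>2 + (norm (w k i \<omega>))\<^sup>2)"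
    using x_sq w_sq[OF i] by (simp add: square_integrable_def)
  then have "integrable M (\<lambda>\<omega>. (norm (w (Suc k) i \<omega>))\<^sup>2)"
    by (rule Bochner_Integration.integrable_bound) (use meas w_step[OF k i] in auto)
  with meas show ?thesis by (simp add: square_integrable_def)
qed

text \<open>The coin is used only through its conditional probability given the past, which determines both
  the old reference point and the iterate that may replace it.\<close>

lemma integral_gradient_gap_reference_Suc:
  assumes i: "i \<in> \<G>"
  shows "(\<integral>\<omega>. gradient_gap (w (Suc k) i \<omega>) \<partial>M)
    = p * (\<integral>\<omega>. gradient_gap (x k \<omega>) \<partial>M) + (1 - p) * (\<integral>\<omega>. gradient_gap (w k i \<omega>) \<partial>M)"
proof -
  let ?B = "{\<omega> \<in> space M. coin k i \<omega>}"
  let ?d = "\<lambda>\<omega>. gradient_gap (x k \<omega>) - gradient_gap (w k i \<omega>)"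
  have gaps: "integrable M (\<lambda>\<omega>. gradient_gap (x k \<omega>))" "integrable M (\<lambda>\<omega>. gradient_gap (w k i \<omega>))"
    by (intro integrable_gradient_gap x_sq w_sq i)+
  have [measurable]: "Measurable.pred M (coin k i)" using coin_random[OF k i] .
  have B: "?B \<in> sets M" by measurable
  have gap_meas: "gradient_gap \<in> borel_measurable borel"
    unfolding gradient_gap_def[abs_def] average_def
    by (intro borel_measurable_scaleR borel_measurable_sum borel_measurable_power
        measurable_compose[OF _ borel_measurable_norm] borel_measurable_diff borel_measurable_gradient)
      auto
  have d_history: "?d \<in> borel_measurable (history k)"
    using k i by (intro borel_measurable_diff measurable_compose[OF _ gap_meas] iterate_history
        reference_history) auto
  have "(\<integral>\<omega>. gradient_gap (w (Suc k) i \<omega>) \<partial>M) = (\<integral>\<omega>. gradient_gap (w k i \<omega>) + ?d \<omega> * indicator ?B \<omega> \<partial>M)"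
    by (intro Bochner_Integration.integral_cong) (auto simp: w_step[OF k i] indicator_def)
  also have "\<dots> = (\<integral>\<omega>. gradient_gap (w k i \<omega>) \<partial>M) + (\<integral>\<omega>. ?d \<omega> * indicator ?B \<omega> \<partial>M)"
    using gaps B by (intro Bochner_Integration.integral_add integrable_real_mult_indicator) auto
  also have "(\<integral>\<omega>. ?d \<omega> * indicator ?B \<omega> \<partial>M) = p * (\<integral>\<omega>. ?d \<omega> \<partial>M)"
    using subalgebra_history[of k] k gaps
    by (intro integral_mult_indicator_cond_prob_const[OF _ B coin_prob[OF k i] d_history]) auto
  finally show ?thesis using gaps by (simp add: algebra_simps)
qed

text \<open>Of the factor \<open>1 + \<gamma> * \<mu> / 2\<close> from Young's inequality, strong convexity takes off \<open>\<gamma> * \<mu>\<close>. The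
  term \<open>- \<gamma> / L\<close> is the gain from the gradient gap in the inner product, and the terms \<open>4 * \<gamma>\<^sup>2\<close> are
  the second moment of the mean message.\<close>

lemma integral_iterate_Suc_le:
  "(\<integral>\<omega>. (norm (x (Suc k) \<omega> - xs))\<^sup>2 \<partial>M)
    \<le> (1 - \<gamma> * \<mu> / 2) * (\<integral>\<omega>. (norm (x k \<omega> - xs))\<^sup>2 \<partial>M)
      + (4 * \<gamma>\<^sup>2 - \<gamma> / L) * (\<integral>\<omega>. gradient_gap (x k \<omega>) \<partial>M)
      + 4 * \<gamma>\<^sup>2 * average \<G> (\<lambda>i. \<integral>\<omega>. gradient_gap (w k i \<omega>) \<partial>M)
      + (2 * \<gamma> / \<mu> + 2 * \<gamma>\<^sup>2) * aggregation_error"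
proof -
  define h where "h \<omega> = average \<G> (\<lambda>i. g k i \<omega>)" for \<omega>
  define e where "e \<omega> = agg k \<omega> - h \<omega>" for \<omega>
  let ?d = "\<lambda>\<omega>. x k \<omega> - xs"
  let ?Q = "\<integral>\<omega>. gradient_gap (x k \<omega>) \<partial>M" and ?R = "average \<G> (\<lambda>i. \<integral>\<omega>. gradient_gap (w k i \<omega>) \<partial>M)"
  have d_sq: "square_integrable M ?d" by (intro square_integrable_diff x_sq square_integrable_const)
  have h_sq: "square_integrable M h"
    unfolding h_def[abs_def] by (intro square_integrable_average message_sq)
  have e_sq: "square_integrable M e" unfolding e_def[abs_def] h_def by (rule error_sq)
  note int = d_sq[unfolded square_integrable_def, THEN conjunct2]
    h_sq[unfolded square_integrable_def, THEN conjunct2]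
    e_sq[unfolded square_integrable_def, THEN conjunct2] square_integrable_inner[OF h_sq d_sq]
  have inner: "?Q / (2 * L) + \<mu> / 2 * (\<integral>\<omega>. (norm (?d \<omega>))\<^sup>2 \<partial>M) \<le> (\<integral>\<omega>. h \<omega> \<bullet> ?d \<omega> \<partial>M)"
  proof -
    have "?Q / (2 * L) + \<mu> / 2 * (\<integral>\<omega>. (norm (?d \<omega>))\<^sup>2 \<partial>M)
        = (\<integral>\<omega>. gradient_gap (x k \<omega>) / (2 * L) + \<mu> / 2 * (norm (?d \<omega>))\<^sup>2 \<partial>M)"
      using int(1) integrable_gradient_gap[OF x_sq] by simp
    also have "\<dots> \<le> (\<integral>\<omega>. full_gradient (x k \<omega>) \<bullet> ?d \<omega> \<partial>M)"
      by (intro integral_mono full_gradient_inner_ge square_integrable_inner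
          square_integrable_full_gradient x_sq d_sq Bochner_Integration.integrable_add
          integrable_divide_zero integrable_mult_right integrable_gradient_gap int)
    also have "\<dots> = average \<G> (\<lambda>i. \<integral>\<omega>. full_gradient (x k \<omega>) \<bullet> ?d \<omega> \<partial>M)"
      by (simp only: average_const[OF regular_nonempty])
    also have "\<dots> = average \<G> (\<lambda>i. \<integral>\<omega>. g k i \<omega> \<bullet> ?d \<omega> \<partial>M)"
    proof (intro average_cong integral_message_inner_history[OF k x_sq w_sq, symmetric])
      show "?d \<in> borel_measurable (history k)"
        using iterate_history[of k] k by (intro borel_measurable_diff) auto
    qed (use d_sq in auto)
    also have "\<dots> = (\<integral>\<omega>. h \<omega> \<bullet> ?d \<omega> \<partial>M)"
      unfolding h_def average_inner_left
      by (intro integral_average[symmetric] square_integrable_inner message_sq d_sq)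
    finally show ?thesis .
  qed
  have second: "(\<integral>\<omega>. (norm (h \<omega>))\<^sup>2 \<partial>M) \<le> 2 * ?Q + 2 * ?R"
  proof -
    have g_int: "integrable M (\<lambda>\<omega>. (norm (g k i \<omega>))\<^sup>2)" if "i \<in> \<G>" for i
      using message_sq[OF _ that] by (simp add: square_integrable_def)
    have "(\<integral>\<omega>. (norm (h \<omega>))\<^sup>2 \<partial>M) \<le> (\<integral>\<omega>. average \<G> (\<lambda>i. (norm (g k i \<omega>))\<^sup>2) \<partial>M)"
      unfolding h_def
      by (intro integral_mono norm_average_sq_le regular_nonempty integrable_average g_int
          int(2)[unfolded h_def])
    also have "\<dots> = average \<G> (\<lambda>i. \<integral>\<omega>. (norm (g k i \<omega>))\<^sup>2 \<partial>M)"
      by (intro integral_average g_int)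
    also have "\<dots> \<le> average \<G> (\<lambda>i. 2 * ?Q + 2 * (\<integral>\<omega>. gradient_gap (w k i \<omega>) \<partial>M))"
      by (intro average_mono integral_norm_message_sq_le[OF k x_sq w_sq])
    finally show ?thesis
      by (simp add: average_add average_mult_left average_const[OF regular_nonempty])
  qed
  have err: "(\<integral>\<omega>. (norm (e \<omega>))\<^sup>2 \<partial>M) \<le> aggregation_error"
    unfolding e_def h_def by (rule integral_aggregation_error_le[OF k x_sq w_sq])
  have "(\<integral>\<omega>. (norm (x (Suc k) \<omega> - xs))\<^sup>2 \<partial>M)
      \<le> (\<integral>\<omega>. (1 + \<gamma> * \<mu> / 2) * (norm (?d \<omega>))\<^sup>2 - 2 * \<gamma> * (h \<omega> \<bullet> ?d \<omega>)
        + 2 * \<gamma>\<^sup>2 * (norm (h \<omega>))\<^sup>2 + (2 * \<gamma> / \<mu> + 2 * \<gamma>\<^sup>2) * (norm (e \<omega>))\<^sup>2 \<partial>M)"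
  proof (rule integral_mono)
    show "integrable M (\<lambda>\<omega>. (norm (x (Suc k) \<omega> - xs))\<^sup>2)"
      using square_integrable_diff[OF square_integrable_iterate_Suc square_integrable_const[of xs]]
      by (simp add: square_integrable_def)
    show "integrable M (\<lambda>\<omega>. (1 + \<gamma> * \<mu> / 2) * (norm (?d \<omega>))\<^sup>2 - 2 * \<gamma> * (h \<omega> \<bullet> ?d \<omega>)
        + 2 * \<gamma>\<^sup>2 * (norm (h \<omega>))\<^sup>2 + (2 * \<gamma> / \<mu> + 2 * \<gamma>\<^sup>2) * (norm (e \<omega>))\<^sup>2)"
      using int by simp
    fix \<omega> assume "\<omega> \<in> space M"
    then have step: "x (Suc k) \<omega> - xs = ?d \<omega> - \<gamma> *\<^sub>R (h \<omega> + e \<omega>)"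
      by (simp add: x_step[OF k] e_def)
    show "(norm (x (Suc k) \<omega> - xs))\<^sup>2 \<le> (1 + \<gamma> * \<mu> / 2) * (norm (?d \<omega>))\<^sup>2 - 2 * \<gamma> * (h \<omega> \<bullet> ?d \<omega>)
        + 2 * \<gamma>\<^sup>2 * (norm (h \<omega>))\<^sup>2 + (2 * \<gamma> / \<mu> + 2 * \<gamma>\<^sup>2) * (norm (e \<omega>))\<^sup>2"
      unfolding step by (rule norm_perturbed_step_sq_le[OF stepsize(1) mu_pos])
  qed
  also have "\<dots> = (1 + \<gamma> * \<mu> / 2) * (\<integral>\<omega>. (norm (?d \<omega>))\<^sup>2 \<partial>M) - 2 * \<gamma> * (\<integral>\<omega>. h \<omega> \<bullet> ?d \<omega> \<partial>M)
      + 2 * \<gamma>\<^sup>2 * (\<integral>\<omega>. (norm (h \<omega>))\<^sup>2 \<partial>M) + (2 * \<gamma> / \<mu> + 2 * \<gamma>\<^sup>2) * (\<integral>\<omega>. (norm (e \<omega>))\<^sup>2 \<partial>M)"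
    using int by simp
  also have "\<dots> \<le> (1 + \<gamma> * \<mu> / 2) * (\<integral>\<omega>. (norm (?d \<omega>))\<^sup>2 \<partial>M)
      - 2 * \<gamma> * (?Q / (2 * L) + \<mu> / 2 * (\<integral>\<omega>. (norm (?d \<omega>))\<^sup>2 \<partial>M))
      + 2 * \<gamma>\<^sup>2 * (2 * ?Q + 2 * ?R) + (2 * \<gamma> / \<mu> + 2 * \<gamma>\<^sup>2) * aggregation_error"
    using stepsize(1) mu_pos
    by (intro add_mono diff_mono mult_left_mono inner second err order_refl) auto
  also have "\<dots> = (1 - \<gamma> * \<mu> / 2) * (\<integral>\<omega>. (norm (?d \<omega>))\<^sup>2 \<partial>M) + (4 * \<gamma>\<^sup>2 - \<gamma> / L) * ?Q
      + 4 * \<gamma>\<^sup>2 * ?R + (2 * \<gamma> / \<mu> + 2 * \<gamma>\<^sup>2) * aggregation_error"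
    using L_pos by (simp add: field_simps)
  finally show ?thesis .
qed

end

section \<open>The recursion for the Lyapunov function\<close>

definition expected_lyapunov :: "nat \<Rightarrow> real" where
  "expected_lyapunov k = (\<integral>\<omega>. lyapunov \<G> m f \<gamma> p xs (x k \<omega>) (\<lambda>i. w k i \<omega>) \<partial>M)"

lemma
  assumes x_sq: "square_integrable M (x k)" and w_sq: "\<And>i. i \<in> \<G> \<Longrightarrow> square_integrable M (w k i)"
  shows integrable_lyapunov: "integrable M (\<lambda>\<omega>. lyapunov \<G> m f \<gamma> p xs (x k \<omega>) (\<lambda>i. w k i \<omega>))"
    and expected_lyapunov_eq: "expected_lyapunov k = (\<integral>\<omega>. (norm (x k \<omega> - xs))\<^sup>2 \<partial>M)
      + 8 * \<gamma>\<^sup>2 / p * average \<G> (\<lambda>i. \<integral>\<omega>. gradient_gap (w k i \<omega>) \<partial>M)"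
proof -
  have d: "integrable M (\<lambda>\<omega>. (norm (x k \<omega> - xs))\<^sup>2)"
    using square_integrable_diff[OF x_sq square_integrable_const[of xs]]
    by (simp add: square_integrable_def)
  have gap: "integrable M (\<lambda>\<omega>. gradient_gap (w k i \<omega>))" if "i \<in> \<G>" for i
    using that by (intro integrable_gradient_gap w_sq)
  show "integrable M (\<lambda>\<omega>. lyapunov \<G> m f \<gamma> p xs (x k \<omega>) (\<lambda>i. w k i \<omega>))"
    unfolding lyapunov_def reference_error_eq
    by (intro Bochner_Integration.integrable_add integrable_mult_right integrable_average d gap)
  show "expected_lyapunov k = (\<integral>\<omega>. (norm (x k \<omega> - xs))\<^sup>2 \<partial>M)
      + 8 * \<gamma>\<^sup>2 / p * average \<G> (\<lambda>i. \<integral>\<omega>. gradient_gap (w k i \<omega>) \<partial>M)"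
  proof -
    have "(\<integral>\<omega>. average \<G> (\<lambda>i. gradient_gap (w k i \<omega>)) \<partial>M) = average \<G> (\<lambda>i. \<integral>\<omega>. gradient_gap (w k i \<omega>) \<partial>M)"
      by (intro integral_average gap)
    moreover have "integrable M (\<lambda>\<omega>. average \<G> (\<lambda>i. gradient_gap (w k i \<omega>)))"
      by (intro integrable_average gap)
    ultimately show ?thesis
      using d by (simp add: expected_lyapunov_def lyapunov_def reference_error_eq)
  qed
qed

text \<open>The weight \<open>8 * \<gamma>\<^sup>2 / p\<close> is twice what is needed to absorb \<open>4 * \<gamma>\<^sup>2\<close> at the rate \<open>p\<close> at which
  references are refreshed; the other half leaves the factor \<open>1 - p / 2\<close>.\<close>

lemma expected_lyapunov_Suc_le:
  assumes k: "k < K" and x_sq: "square_integrable M (x k)"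
    and w_sq: "\<And>i. i \<in> \<G> \<Longrightarrow> square_integrable M (w k i)"
  shows "expected_lyapunov (Suc k) \<le> (1 - \<gamma> * \<mu> / 2) * expected_lyapunov k
    + (2 * \<gamma> / \<mu> + 2 * \<gamma>\<^sup>2) * aggregation_error"
proof -
  let ?X = "\<lambda>k. \<integral>\<omega>. (norm (x k \<omega> - xs))\<^sup>2 \<partial>M" and ?Q = "\<integral>\<omega>. gradient_gap (x k \<omega>) \<partial>M"
  let ?R = "\<lambda>k. average \<G> (\<lambda>i. \<integral>\<omega>. gradient_gap (w k i \<omega>) \<partial>M)"
  let ?C = "(2 * \<gamma> / \<mu> + 2 * \<gamma>\<^sup>2) * aggregation_error"
  have R_Suc: "?R (Suc k) = p * ?Q + (1 - p) * ?R k"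
  proof -
    have "?R (Suc k) = average \<G> (\<lambda>i. p * ?Q + (1 - p) * (\<integral>\<omega>. gradient_gap (w k i \<omega>) \<partial>M))"
      by (intro average_cong integral_gradient_gap_reference_Suc assms)
    then show ?thesis by (simp add: average_add average_mult_left average_const[OF regular_nonempty])
  qed
  have Q: "0 \<le> ?Q" by (intro integral_nonneg_AE AE_I2 gradient_gap_nonneg)
  have R: "0 \<le> ?R k" by (intro average_nonneg integral_nonneg_AE AE_I2 gradient_gap_nonneg)
  have "expected_lyapunov (Suc k) = ?X (Suc k) + 8 * \<gamma>\<^sup>2 / p * ?R (Suc k)"
    by (intro expected_lyapunov_eq square_integrable_iterate_Suc square_integrable_reference_Suc assms)
  also have "\<dots> \<le> (1 - \<gamma> * \<mu> / 2) * ?X k + (4 * \<gamma>\<^sup>2 - \<gamma> / L) * ?Q + 4 * \<gamma>\<^sup>2 * ?R k + ?C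
      + 8 * \<gamma>\<^sup>2 / p * ?R (Suc k)"
    by (intro add_right_mono integral_iterate_Suc_le assms)
  also have "\<dots> = (1 - \<gamma> * \<mu> / 2) * ?X k + (12 * \<gamma>\<^sup>2 - \<gamma> / L) * ?Q
      + 8 * \<gamma>\<^sup>2 / p * ((1 - p / 2) * ?R k) + ?C"
    unfolding R_Suc using prob(1) by (simp add: field_simps)
  also have "\<dots> \<le> (1 - \<gamma> * \<mu> / 2) * ?X k + 0 + 8 * \<gamma>\<^sup>2 / p * ((1 - \<gamma> * \<mu> / 2) * ?R k) + ?C"
  proof -
    have "\<gamma> * (12 * \<gamma>) \<le> \<gamma> * (1 / L)"
      using stepsize(1,2) L_pos by (intro mult_left_mono) (auto simp: field_simps)
    then have "12 * \<gamma>\<^sup>2 - \<gamma> / L \<le> 0" by (simp add: power2_eq_square)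
    then have "(12 * \<gamma>\<^sup>2 - \<gamma> / L) * ?Q \<le> 0" using Q by (rule mult_nonpos_nonneg)
    moreover have "1 - p / 2 \<le> 1 - \<gamma> * \<mu> / 2"
      using stepsize(3) mu_pos by (simp add: field_simps)
    ultimately show ?thesis
      using prob(1) R by (intro add_mono mult_left_mono mult_right_mono order_refl) auto
  qed
  also have "\<dots> = (1 - \<gamma> * \<mu> / 2) * expected_lyapunov k + ?C"
  proof -
    have "expected_lyapunov k = ?X k + 8 * \<gamma>\<^sup>2 / p * ?R k"
      by (intro expected_lyapunov_eq x_sq w_sq)
    then show ?thesis by (simp only: distrib_left add_0_right mult.left_commute)
  qed
  finally show ?thesis .
qed

text \<open>Integrability is carried along the run, because the aggregation error of a step is controlled
  only once the iterate and the references of that step are square-integrable.\<close>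

lemma square_integrable_run:
  "k \<le> K \<Longrightarrow> square_integrable M (x k) \<and> (\<forall>i\<in>\<G>. square_integrable M (w k i))"
proof (induction k)
  case 0
  have "square_integrable M X" if "\<And>\<omega>. \<omega> \<in> space M \<Longrightarrow> X \<omega> = x0" for X
  proof -
    have "X \<in> borel_measurable M \<longleftrightarrow> (\<lambda>_. x0) \<in> borel_measurable M"
      by (intro measurable_cong that)
    then show ?thesis
      using that by (intro square_integrable_cong_AE[OF square_integrable_const[of x0]]) auto
  qed
  then show ?case using x_init w_init by blast
next
  case (Suc k)
  then show ?case
    using square_integrable_iterate_Suc[of k] square_integrable_reference_Suc[of k] by auto
qed

text \<open>The additive constant is the fixed point of \<open>y \<mapsto> (1 - \<gamma> * \<mu> / 2) * y + C\<close>, so the recursion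
  preserves the bound.\<close>

lemma expected_lyapunov_le:
  assumes "k \<le> K"
  shows "expected_lyapunov k \<le> (1 - \<gamma> * \<mu> / 2) ^ k * expected_lyapunov 0
    + (2 * \<gamma> / \<mu> + 2 * \<gamma>\<^sup>2) * aggregation_error / (\<gamma> * \<mu> / 2)"
  using assms
proof (induction k)
  case 0
  then show ?case using stepsize(1) mu_pos aggregation_error_nonneg by simp
next
  case (Suc k)
  let ?q = "1 - \<gamma> * \<mu> / 2" and ?C = "(2 * \<gamma> / \<mu> + 2 * \<gamma>\<^sup>2) * aggregation_error"
  have "\<gamma> * \<mu> \<le> p" using stepsize(3) mu_pos by (simp add: field_simps)
  then have q: "0 \<le> ?q" using prob(2) by simp
  have "expected_lyapunov (Suc k) \<le> ?q * expected_lyapunov k + ?C"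
    using Suc.prems square_integrable_run[of k] by (intro expected_lyapunov_Suc_le) auto
  also have "\<dots> \<le> ?q * (?q ^ k * expected_lyapunov 0 + ?C / (\<gamma> * \<mu> / 2)) + ?C"
    using Suc q by (intro add_right_mono mult_left_mono) auto
  also have "?q * (?q ^ k * expected_lyapunov 0 + ?C / (\<gamma> * \<mu> / 2)) + ?C
      = ?q ^ Suc k * expected_lyapunov 0 + (?q * (?C / (\<gamma> * \<mu> / 2)) + ?C)"
    by (simp add: algebra_simps)
  also have "?q * (?C / (\<gamma> * \<mu> / 2)) + ?C = ?C / (\<gamma> * \<mu> / 2)"
  proof -
    have "(1 - r) * (C / r) + C = C / r" if "r \<noteq> 0" for r C :: real
      using that by (simp add: field_simps)
    moreover have "\<gamma> * \<mu> / 2 \<noteq> 0" using stepsize(1) mu_pos by simp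
    ultimately show ?thesis by blast
  qed
  finally show ?case .
qed

lemma expected_lyapunov_0: "expected_lyapunov 0 = lyapunov \<G> m f \<gamma> p xs x0 (\<lambda>i. x0)"
proof -
  have "expected_lyapunov 0 = (\<integral>\<omega>. lyapunov \<G> m f \<gamma> p xs x0 (\<lambda>i. x0) \<partial>M)"
    unfolding expected_lyapunov_def lyapunov_def reference_error_eq
    by (intro Bochner_Integration.integral_cong refl) (auto simp: x_init w_init cong: average_cong)
  then show ?thesis by (simp add: prob_space)
qed

end

theorem theorem1:
  fixes M :: "'\<omega> measure"
    and n m b K :: nat
    and \<G> \<B> :: "nat set"
    and f :: "nat \<Rightarrow> 'v::euclidean_space \<Rightarrow> real"
    and A :: "(nat \<Rightarrow> 'v) \<Rightarrow> 'v measure"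
    and L \<mu> \<sigma> \<delta> c \<gamma> p :: real
    and x0 xs :: 'v
    and x :: "nat \<Rightarrow> '\<omega> \<Rightarrow> 'v"
    and w g :: "nat \<Rightarrow> nat \<Rightarrow> '\<omega> \<Rightarrow> 'v"
    and smp :: "nat \<Rightarrow> nat \<Rightarrow> nat \<Rightarrow> '\<omega> \<Rightarrow> nat"
    and coin :: "nat \<Rightarrow> nat \<Rightarrow> '\<omega> \<Rightarrow> bool"
    and agg :: "nat \<Rightarrow> '\<omega> \<Rightarrow> 'v"
  assumes workers: "{1..n} = \<G> \<union> \<B>" "\<G> \<inter> \<B> = {}"
    and delta: "0 \<le> \<delta>" "\<delta> < 1 / 2"
    and regular: "(1 - \<delta>) * real n \<le> real (card \<G>)" "2 \<le> card \<G>"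
    and components: "1 \<le> m"
    and L_pos: "0 < L"
    and smooth: "\<And>j. j \<in> {1..m} \<Longrightarrow> smooth L (f j)"
    and convex: "\<And>j y z. j \<in> {1..m} \<Longrightarrow> f j z \<ge> f j y + gradient (f j) y \<bullet> (z - y)"
    and mu_pos: "0 < \<mu>"
    and strongly_convex: "\<And>y z. objective m f z \<ge>
      objective m f y + gradient (objective m f) y \<bullet> (z - y) + \<mu> / 2 * (norm (z - y))\<^sup>2"
    and minimizer: "\<And>y. objective m f xs \<le> objective m f y"
    and sigma_nonneg: "0 \<le> \<sigma>"
    and bounded_variance: "\<And>y. measure_pmf.expectation (pmf_of_set {1..m})
      (\<lambda>j. (norm (gradient (f j) y - gradient (objective m f) y))\<^sup>2) \<le> \<sigma>\<^sup>2"
    and c_pos: "0 < c"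
    and aggregator: "agnostic_robust_aggregator n \<delta> c A"
    and batch: "1 \<le> b"
    and prob: "0 < p" "p \<le> 1"
    and stepsize: "0 < \<gamma>" "\<gamma> \<le> min (1 / (12 * L)) (p / \<mu>)"
    and run: "br_lsvrg M n \<G> m f A \<gamma> b p x0 K x w g smp coin agg"
  shows "integrable M (\<lambda>\<omega>. lyapunov \<G> m f \<gamma> p xs (x K \<omega>) (\<lambda>i. w K i \<omega>)) \<and>
    prob_space.expectation M (\<lambda>\<omega>. lyapunov \<G> m f \<gamma> p xs (x K \<omega>) (\<lambda>i. w K i \<omega>))
      \<le> (1 - \<gamma> * \<mu> / 2) ^ K * lyapunov \<G> m f \<gamma> p xs x0 (\<lambda>i. x0)
        + \<gamma> * (32 * c * \<delta> * \<sigma>\<^sup>2 / (real b * \<mu>)) + 32 * c * \<delta> * \<sigma>\<^sup>2 / (real b * \<mu>\<^sup>2)"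
proof -
  interpret br_lsvrg M n \<G> m f A \<gamma> b p x0 K x w g smp coin agg by (rule run)
  interpret br_lsvrg_run M n \<G> m f A \<gamma> b p x0 K x w g smp coin agg L \<mu> \<sigma> xs \<delta> c
    by unfold_locales
      (use workers delta regular components L_pos smooth convex mu_pos strongly_convex minimizer
        bounded_variance c_pos aggregator batch prob stepsize in auto)
  have "(2 * \<gamma> / \<mu> + 2 * \<gamma>\<^sup>2) * aggregation_error / (\<gamma> * \<mu> / 2)
      = \<gamma> * (32 * c * \<delta> * \<sigma>\<^sup>2 / (real b * \<mu>)) + 32 * c * \<delta> * \<sigma>\<^sup>2 / (real b * \<mu>\<^sup>2)"
    using stepsize(1) mu_pos batch
    by (simp add: aggregation_error_def field_simps power2_eq_square)
  with expected_lyapunov_le[of K] have "expected_lyapunov K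
      \<le> (1 - \<gamma> * \<mu> / 2) ^ K * lyapunov \<G> m f \<gamma> p xs x0 (\<lambda>i. x0)
        + \<gamma> * (32 * c * \<delta> * \<sigma>\<^sup>2 / (real b * \<mu>)) + 32 * c * \<delta> * \<sigma>\<^sup>2 / (real b * \<mu>\<^sup>2)"
    by (simp add: expected_lyapunov_0)
  moreover have "integrable M (\<lambda>\<omega>. lyapunov \<G> m f \<gamma> p xs (x K \<omega>) (\<lambda>i. w K i \<omega>))"
    using square_integrable_run[of K] by (intro integrable_lyapunov) auto
  ultimately show ?thesis by (simp add: expected_lyapunov_def)
qed

end
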